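(* Let $P(\lambda)=\sum_{i=0}^k\lambda^iA_i$ be a regular $n\times n$ matrix polynomial of degree $k$ with $A_i\in\mathbb{C}^{n\times n}$, and let $1\leqslant r<kn$. For a positive integer $t$ let $\mathbb{S}^t$ be the set of column vectors of length $t$ with positive entries, and for $a=[a_1,\dots,a_t]^T\in\mathbb{S}^t$ and a positive integer $m$ let $W_{t,m}(a):=\mathrm{diag}(a_1,\dots,a_t)\otimes I_m$. Let $\lambda_0\in\mathbb{C}$ be a scalar which is not an eigenvalue of $P(\lambda)$. Then for $s=2$ or $F$, $$\delta_s(P,\lambda_0,r+1)\geqslant\sup_{a\in\mathbb{S}^{r+1}}\left(\sigma_{r+1}(B(\lambda_0,a,P))\right)^{-1},$$ where $B(\lambda_0,a,P):=W_{r+1,(k+1)n}(a)\,(I_{r+1}\otimes M(\lambda_0;r))\,E\,(T(P,\lambda_0))^{-1}\,W_{r+1,n}^{-1}(a)$. If $\lambda_0=0$, then for $s=2$ or $F$, $$\delta_s(P,0,r+1)\geqslant\sup_{a\in\mathbb{S}^{r+1}}\left(\sigma_{r+1}(\widehat B(0,a,P))\right)^{-1},$$ where $\widehat B(0,a,P):=W_{r+1,(\min\{r,k\}+1)n}(a)\,E\,(T(P,0))^{-1}\,W_{r+1,n}^{-1}(a)$.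
   Context: $\sigma_i(A)$ is the $i$-th singular value of $A$ in decreasing order; $\|\cdot\|_2$ and $\|\cdot\|_F$ are the spectral and Frobenius norms; $P^i$ is the $i$-th derivative of $P$. $P$ is regular if $\det P(\lambda)\not\equiv0$; its eigenvalues are then the roots of $\det P(\lambda)$. $T(P,\lambda_0)$ is the $(r+1)n\times(r+1)n$ block lower triangular Toeplitz matrix whose $n\times n$ block $(i,j)$ is $\frac{1}{(i-j)!}P^{i-j}(\lambda_0)$ for $i\geqslant j$ and $0$ for $i<j$ ($1\leqslant i,j\leqslant r+1$). $M(\lambda_0;r)=H(\lambda_0)\otimes I_n$, where $H(\lambda_0)$ is the $(k+1)\times(\min\{r,k\}+1)$ matrix with $(i,j)$ entry $\left.\frac{1}{(j-1)!}\frac{d^{j-1}\lambda^{i-1}}{d\lambda^{j-1}}\right|_{\lambda=\lambda_0}$. For $i=1,\dots,r+1$ let $E_i$ be the $(r+1)\times(r+1)$ matrix with $(a,b)$ entry equal to $1$ if $a+b=i+1$ and $0$ otherwise, and let $\tilde E_i\in\mathbb{C}^{(k+1)\times(r+1)}$ (used when $r>k$) consist of the first $k+1$ rows of $E_i$. Then $E=\begin{bmatrix}E_1^T&\cdots&E_{r+1}^T\end{bmatrix}^T\otimes I_n$ if $r\leqslant k$, and $E=\begin{bmatrix}\tilde E_1^T&\cdots&\tilde E_{r+1}^T\end{bmatrix}^T\otimes I_n$ if $r>k$. For $\Delta P(\lambda)=\sum_{i=0}^k\lambda^i\Delta A_i$, put $|||\Delta P|||_F=\left(\sum_{i=0}^k\|\Delta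 A_i\|_F^2\right)^{1/2}$ and $|||\Delta P|||_2=\|[\Delta A_0\ \cdots\ \Delta A_k]\|_2$. For $s=2$ or $F$, $\delta_s(P,\lambda_0,r+1)$ is the infimum of $|||\Delta P|||_s$ over all $\Delta P(\lambda)=\sum_{i=0}^k\lambda^i\Delta A_i$, $\Delta A_i\in\mathbb{C}^{n\times n}$ (any of which may be zero), such that $P+\Delta P$ has an elementary divisor $(\lambda-\lambda_0)^j$ with $j\geqslant r+1$. Elementary divisors are defined via the Smith form: $P(\lambda)=E_0(\lambda)D(\lambda)F_0(\lambda)$ with $E_0,F_0$ matrix polynomials with nonzero constant determinants and $D=\mathrm{diag}(d_1,\dots,d_t,0,\dots,0)$, $d_i$ monic, $d_{i-1}\mid d_i$; if $d_i(\lambda)=\prod_j(\lambda-\lambda_{ij})^{c_{ij}}$ with distinct $\lambda_{ij}$ and $c_{ij}\geqslant1$, the factors $(\lambda-\lambda_{ij})^{c_{ij}}$ are the elementary divisors. *)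

theory Defs
  imports
    "Jordan_Normal_Form.Schur_Decomposition"
    "Jordan_Normal_Form.Gauss_Jordan_Elimination"
    "HOL-Library.Extended_Real"
begin

section \<open>Norms, singular values, Kronecker product\<close>

definition vec_norm2 :: "complex vec \<Rightarrow> real" where
  "vec_norm2 x = sqrt (\<Sum>i<dim_vec x. (cmod (x $ i))\<^sup>2)"

definition spectral_norm :: "complex mat \<Rightarrow> real" where
  "spectral_norm A =
     (SUP x \<in> {x \<in> carrier_vec (dim_col A). vec_norm2 x \<le> 1}. vec_norm2 (A *\<^sub>v x))"

definition frobenius_norm :: "complex mat \<Rightarrow> real" where
  "frobenius_norm A = sqrt (\<Sum>i<dim_row A. \<Sum>j<dim_col A. (cmod (A $$ (i, j)))\<^sup>2)"

text \<open>The singular values are the square roots of the eigenvalues of \<open>A\<^sup>* A\<close>, which are real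
  and nonnegative, counted with algebraic multiplicity and listed in decreasing order.
  The index of \<open>sing_val\<close> starts at 1. If \<open>A\<close> has more columns than rows, the list is the usual
  one followed by additional zeros.\<close>

definition sing_vals :: "complex mat \<Rightarrow> real list" where
  "sing_vals A = rev (sorted_list_of_multiset
     (image_mset (\<lambda>z. sqrt (Re z)) (proots (char_poly (mat_adjoint A * A)))))"

definition sing_val :: "nat \<Rightarrow> complex mat \<Rightarrow> real" where
  "sing_val i A = sing_vals A ! (i - 1)"

definition kron :: "'a :: semiring_1 mat \<Rightarrow> 'a mat \<Rightarrow> 'a mat" where
  "kron A B = mat (dim_row A * dim_row B) (dim_col A * dim_col B)
     (\<lambda>(i, j). A $$ (i div dim_row B, j div dim_col B) * B $$ (i mod dim_row B, j mod dim_col B))"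

text \<open>Only meaningful for invertible square matrices; otherwise \<open>mat_inverse\<close> is \<open>None\<close>.\<close>

definition mat_inv :: "'a :: field mat \<Rightarrow> 'a mat" where
  "mat_inv A = the (mat_inverse A)"


section \<open>Matrix polynomials\<close>

text \<open>A matrix polynomial is represented as a matrix with polynomial entries;
  \<open>mat_poly n k A\<close> is the sum of the \<open>\<lambda>\<^sup>i A\<^sub>i\<close> with \<open>i \<le> k\<close>.\<close>

definition mat_poly :: "nat \<Rightarrow> nat \<Rightarrow> (nat \<Rightarrow> complex mat) \<Rightarrow> complex poly mat" where
  "mat_poly n k A = mat n n (\<lambda>(a, b). \<Sum>i\<le>k. monom (A i $$ (a, b)) i)"

definition mat_poly_deriv_at :: "nat \<Rightarrow> complex poly mat \<Rightarrow> complex \<Rightarrow> complex mat" where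
  "mat_poly_deriv_at i P z = map_mat (\<lambda>p. poly ((pderiv ^^ i) p) z) P"

definition regular_mat_poly :: "complex poly mat \<Rightarrow> bool" where
  "regular_mat_poly P \<longleftrightarrow> det P \<noteq> 0"

text \<open>Only meaningful for regular \<open>P\<close>.\<close>

definition mat_poly_eigenvalue :: "complex poly mat \<Rightarrow> complex \<Rightarrow> bool" where
  "mat_poly_eigenvalue P z \<longleftrightarrow> poly (det P) z = 0"

definition unimodular_mat_poly :: "nat \<Rightarrow> complex poly mat \<Rightarrow> bool" where
  "unimodular_mat_poly n E \<longleftrightarrow> E \<in> carrier_mat n n \<and> (\<exists>c. c \<noteq> 0 \<and> det E = [:c:])"

definition is_smith_form :: "nat \<Rightarrow> complex poly mat \<Rightarrow> complex poly list \<Rightarrow> bool" where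
  "is_smith_form n P ds \<longleftrightarrow>
     length ds \<le> n \<and>
     (\<forall>d \<in> set ds. lead_coeff d = 1) \<and>
     (\<forall>i. 0 < i \<and> i < length ds \<longrightarrow> ds ! (i - 1) dvd ds ! i) \<and>
     (\<exists>E F. unimodular_mat_poly n E \<and> unimodular_mat_poly n F \<and>
        P = E * mat_diag n (\<lambda>i. if i < length ds then ds ! i else 0) * F)"

definition elementary_divisor :: "nat \<Rightarrow> complex poly mat \<Rightarrow> complex poly \<Rightarrow> bool" where
  "elementary_divisor n P q \<longleftrightarrow>
     (\<exists>ds d (S :: complex set) c. is_smith_form n P ds \<and> d \<in> set ds \<and> finite S \<and>
        (\<forall>z \<in> S. c z \<ge> 1) \<and> d = (\<Prod>z\<in>S. [:-z, 1:] ^ c z) \<and>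
        (\<exists>z \<in> S. q = [:-z, 1:] ^ c z))"


section \<open>Perturbation norms and the distance\<close>

datatype norm_type = Spectral | Frobenius

definition coeff_row :: "nat \<Rightarrow> nat \<Rightarrow> (nat \<Rightarrow> complex mat) \<Rightarrow> complex mat" where
  "coeff_row n k A = mat n ((k + 1) * n) (\<lambda>(i, j). A (j div n) $$ (i, j mod n))"

fun tri_norm :: "norm_type \<Rightarrow> nat \<Rightarrow> nat \<Rightarrow> (nat \<Rightarrow> complex mat) \<Rightarrow> real" where
  "tri_norm Spectral n k A = spectral_norm (coeff_row n k A)"
| "tri_norm Frobenius n k A = sqrt (\<Sum>i\<le>k. (frobenius_norm (A i))\<^sup>2)"

text \<open>The infimum is taken in the extended reals, so that it would be \<open>\<infinity>\<close> over the empty set.\<close>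

definition ed_dist :: "norm_type \<Rightarrow> nat \<Rightarrow> nat \<Rightarrow> complex poly mat \<Rightarrow> complex \<Rightarrow> nat \<Rightarrow> ereal" where
  "ed_dist s n k P z m =
     (INF \<Delta> \<in> {\<Delta>. (\<forall>i\<le>k. \<Delta> i \<in> carrier_mat n n) \<and>
               (\<exists>j\<ge>m. elementary_divisor n (P + mat_poly n k \<Delta>) ([:-z, 1:] ^ j))}.
        ereal (tri_norm s n k \<Delta>))"


section \<open>The structured matrices\<close>

text \<open>Throughout, row and column indices start at 0, so that the \<open>(i, j)\<close> entry or block below
  is the \<open>(i + 1, j + 1)\<close> one of the usual notation. In particular the condition
  \<open>a + b = i + 1\<close> on the entries of \<open>E\<^sub>i\<close> becomes \<open>a + b = i\<close>.\<close>

definition toeplitz :: "nat \<Rightarrow> nat \<Rightarrow> complex poly mat \<Rightarrow> complex \<Rightarrow> complex mat" where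
  "toeplitz n r P z = mat ((r + 1) * n) ((r + 1) * n)
     (\<lambda>(a, b). let i = a div n; j = b div n in
        if j \<le> i
        then 1 / fact (i - j) * mat_poly_deriv_at (i - j) P z $$ (a mod n, b mod n)
        else 0)"

definition H_mat :: "nat \<Rightarrow> nat \<Rightarrow> complex \<Rightarrow> complex mat" where
  "H_mat k r z = mat (k + 1) (min r k + 1)
     (\<lambda>(i, j). 1 / fact j * poly ((pderiv ^^ j) (monom 1 i)) z)"

definition M_mat :: "nat \<Rightarrow> nat \<Rightarrow> nat \<Rightarrow> complex \<Rightarrow> complex mat" where
  "M_mat n k r z = kron (H_mat k r z) (1\<^sub>m n)"

definition E_block :: "nat \<Rightarrow> nat \<Rightarrow> complex mat" where
  "E_block r i = mat (r + 1) (r + 1) (\<lambda>(a, b). if a + b = i then 1 else 0)"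

text \<open>The first \<open>min r k + 1\<close> rows of each \<open>E_block\<close> are stacked: these are all rows if
  \<open>r \<le> k\<close> and the first \<open>k + 1\<close> rows if \<open>r > k\<close>.\<close>

definition E_mat :: "nat \<Rightarrow> nat \<Rightarrow> nat \<Rightarrow> complex mat" where
  "E_mat n k r = kron
     (mat ((r + 1) * (min r k + 1)) (r + 1)
        (\<lambda>(p, b). E_block r (p div (min r k + 1)) $$ (p mod (min r k + 1), b)))
     (1\<^sub>m n)"

definition pos_vecs :: "nat \<Rightarrow> real vec set" where
  "pos_vecs t = {a \<in> carrier_vec t. \<forall>i<t. a $ i > 0}"

definition W_mat :: "nat \<Rightarrow> nat \<Rightarrow> real vec \<Rightarrow> complex mat" where
  "W_mat t m a = kron (mat_diag t (\<lambda>i. complex_of_real (a $ i))) (1\<^sub>m m)"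

definition B_mat ::
  "nat \<Rightarrow> nat \<Rightarrow> nat \<Rightarrow> complex \<Rightarrow> real vec \<Rightarrow> complex poly mat \<Rightarrow> complex mat" where
  "B_mat n k r z a P =
     W_mat (r + 1) ((k + 1) * n) a * kron (1\<^sub>m (r + 1)) (M_mat n k r z) * E_mat n k r
       * mat_inv (toeplitz n r P z) * mat_inv (W_mat (r + 1) n a)"

definition B_hat_mat ::
  "nat \<Rightarrow> nat \<Rightarrow> nat \<Rightarrow> complex \<Rightarrow> real vec \<Rightarrow> complex poly mat \<Rightarrow> complex mat" where
  "B_hat_mat n k r z a P =
     W_mat (r + 1) ((min r k + 1) * n) a * E_mat n k r
       * mat_inv (toeplitz n r P z) * mat_inv (W_mat (r + 1) n a)"

end

theory Submission
  imports Defs "HOL-Analysis.L2_Norm"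
begin

text \<open>
  Suppose that \<open>Q = P + \<Delta>P\<close> has an elementary divisor \<open>(\<lambda> - z)\<^sup>j\<close> with \<open>j \<ge> r + 1\<close>. The Smith form
  yields a vector polynomial \<open>x\<close> with \<open>x(z) \<noteq> 0\<close> such that \<open>Q x\<close> is divisible by
  \<open>(\<lambda> - z)\<close> to the power \<open>r + 1\<close> (\<open>elementary_divisor_local_kernel\<close>). The
  products \<open>c x\<close> with polynomials \<open>c\<close> have the same divisibility, so the Taylor coefficients of \<open>x\<close>,
  shifted by \<open>0, \<dots>, r\<close> blocks, span a space of dimension \<open>r + 1\<close> in the
  kernel of \<open>T(Q) = T(P) + T(\<Delta>P)\<close>. As \<open>T(P)\<close> is invertible, there is a space of dimension
  \<open>r + 1\<close> on which \<open>T(\<Delta>P) T(P)\<^sup>-\<^sup>1\<close> is minus the identity; conjugation with the weights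
  does not change this.

  The matrices \<open>M\<close> and \<open>E\<close> are designed so that
  \<open>T(\<Delta>P) = (I \<otimes> [\<Delta>A\<^sub>0 \<dots> \<Delta>A\<^sub>k]) (I \<otimes> M) E\<close>, and the weights commute with the first factor. On this
  space every vector \<open>v\<close> therefore satisfies \<open>v = - (I \<otimes> [\<Delta>A\<^sub>0 \<dots> \<Delta>A\<^sub>k]) B v\<close>, so the norm of \<open>v\<close>
  is at most the spectral norm of \<open>[\<Delta>A\<^sub>0 \<dots> \<Delta>A\<^sub>k]\<close> times the norm of \<open>B v\<close>. The Courant-Fischer
  principle (\<open>sing_val_lower_bound\<close>) turns this into a lower bound for the singular value number
  \<open>r + 1\<close> of \<open>B\<close> (\<open>B_mat_lower_bound\<close>). The Frobenius norm is at least the spectral norm, which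
  covers both cases.

  All computations with the structured matrices are read as multiplication of polynomials in the
  variable \<open>\<lambda> - z\<close>, truncated after degree \<open>r\<close>. For \<open>z = 0\<close> the factor \<open>I \<otimes> M\<close> is an isometry
  that only inserts zeros, so leaving it out does not change the singular values
  (\<open>sing_val_B_hat\<close>).
\<close>

section \<open>Adjoints, Euclidean norm and unitary matrices\<close>

lemma mat_adjoint_carrier [simp]: "A \<in> carrier_mat m n \<Longrightarrow> mat_adjoint A \<in> carrier_mat n m"
  by (auto simp: mat_adjoint_def)

lemma dim_mat_adjoint [simp]: "dim_row (mat_adjoint A) = dim_col A" "dim_col (mat_adjoint A) = dim_row A"
  by (auto simp: mat_adjoint_def)

lemma mat_adjoint_index [simp]:
  "i < dim_col A \<Longrightarrow> j < dim_row A \<Longrightarrow> mat_adjoint A $$ (i, j) = conjugate (A $$ (j, i))"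
  by (simp add: mat_adjoint_def mat_of_rows_index)

lemma mat_adjoint_mult:
  fixes A :: "complex mat"
  assumes "A \<in> carrier_mat m n" "B \<in> carrier_mat n p"
  shows "mat_adjoint (A * B) = mat_adjoint B * mat_adjoint A"
  using assms
  by (intro eq_matI) (auto simp: scalar_prod_def mult.commute)

lemma mat_adjoint_adjoint [simp]: "mat_adjoint (mat_adjoint A) = A"
  by (intro eq_matI) auto

lemma cscalar_prod_adjoint:
  fixes A :: "complex mat"
  assumes "A \<in> carrier_mat m n" "x \<in> carrier_vec n" "y \<in> carrier_vec m"
  shows "(A *\<^sub>v x) \<bullet>c y = x \<bullet>c (mat_adjoint A *\<^sub>v y)"
proof -
  have "(A *\<^sub>v x) \<bullet>c y = (\<Sum>i<m. (\<Sum>j<n. A $$ (i,j) * x $ j) * cnj (y $ i))"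
    using assms by (auto simp: scalar_prod_def atLeast0LessThan)
  also have "\<dots> = (\<Sum>j<n. \<Sum>i<m. A $$ (i,j) * x $ j * cnj (y $ i))"
    by (subst sum.swap) (simp add: sum_distrib_right)
  also have "\<dots> = (\<Sum>j<n. x $ j * cnj (\<Sum>i<m. cnj (A $$ (i,j)) * y $ i))"
    by (simp add: sum_distrib_left mult_ac)
  also have "\<dots> = x \<bullet>c (mat_adjoint A *\<^sub>v y)"
    using assms by (auto simp: scalar_prod_def atLeast0LessThan)
  finally show ?thesis .
qed

lemma vec_norm2_nonneg: "0 \<le> vec_norm2 x"
  by (simp add: vec_norm2_def sum_nonneg)

lemma vec_norm2_square: "(vec_norm2 x)\<^sup>2 = (\<Sum>i<dim_vec x. (cmod (x $ i))\<^sup>2)"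
  by (simp add: vec_norm2_def sum_nonneg)

lemma cscalar_prod_self: "x \<bullet>c x = complex_of_real ((vec_norm2 x)\<^sup>2)"
  unfolding vec_norm2_square
  by (simp add: scalar_prod_def atLeast0LessThan complex_norm_square[symmetric])

lemma vec_norm2_eq_0: "x \<in> carrier_vec n \<Longrightarrow> vec_norm2 x = 0 \<longleftrightarrow> x = 0\<^sub>v n"
  by (metis cscalar_prod_self conjugate_square_eq_0_vec of_real_eq_0_iff power_eq_0_iff
     power_zero_numeral of_real_0 conjugate_zero_vec)

definition unitary_mat :: "nat \<Rightarrow> complex mat \<Rightarrow> bool" where
  "unitary_mat n U \<longleftrightarrow> U \<in> carrier_mat n n \<and> mat_adjoint U * U = 1\<^sub>m n"

lemma unitary_matD:
  assumes "unitary_mat n U"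
  shows "U \<in> carrier_mat n n" "mat_adjoint U * U = 1\<^sub>m n" "U * mat_adjoint U = 1\<^sub>m n"
  using assms mat_mult_left_right_inverse[of "mat_adjoint U" n U] by (auto simp: unitary_mat_def)

lemma unitary_mat_mult:
  assumes "unitary_mat n U" "unitary_mat n V"
  shows "unitary_mat n (U * V)"
proof -
  note U = unitary_matD[OF assms(1)] and V = unitary_matD[OF assms(2)]
  have "mat_adjoint (U * V) * (U * V) = mat_adjoint V * (mat_adjoint U * U) * V"
    using U(1) V(1) by (simp add: mat_adjoint_mult assoc_mult_mat[of _ n n _ n _ n] mult_carrier_mat[of _ n n _ n])
  thus ?thesis using U V by (simp add: unitary_mat_def)
qed

text \<open>Gram-Schmidt applied to a basis that starts with \<open>v\<close> keeps the direction of \<open>v\<close>;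
  dividing the resulting orthogonal vectors by their norms gives the columns of \<open>W\<close>.\<close>

lemma unitary_completion:
  assumes v: "v \<in> carrier_vec n" and v0: "v \<noteq> 0\<^sub>v n"
  obtains W c where "unitary_mat n W" "col W 0 = c \<cdot>\<^sub>v v"
proof -
  interpret cof_vec_space n "TYPE(complex)" .
  define b where "b = basis_completion v"
  define ws where "ws = gram_schmidt n b"
  from basis_completion[OF v v0, folded b_def]
  have b: "distinct b" "\<not> lin_dep (set b)" "set b \<subseteq> carrier_vec n" "hd b = v" "length b = n"
    by auto
  have n: "n \<noteq> 0" using v v0 by (cases n) auto
  then obtain vs where bv: "b = v # vs" using b by (cases b) auto
  from gram_schmidt_result[OF b(3,1,2) refl, folded ws_def] b(5)
  have ws: "set ws \<subseteq> carrier_vec n" "corthogonal ws" "length ws = n" by auto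
  have hd: "ws ! 0 = v"
    using gram_schmidt_hd[OF v, of vs, folded bv] ws(3) n by (cases ws) (auto simp: ws_def)
  have wsi: "ws ! i \<in> carrier_vec n" if "i < n" for i using that ws by auto
  define W where "W = mat n n (\<lambda>(i,j). complex_of_real (1 / vec_norm2 (ws ! j)) * ws ! j $ i)"
  have ne: "vec_norm2 (ws ! j) \<noteq> 0" if "j < n" for j
    using corthogonalD[OF ws(2), of j j] that ws(3) unfolding cscalar_prod_self by auto
  have "mat_adjoint W * W = 1\<^sub>m n"
  proof (rule eq_matI)
    fix i j assume ij: "i < dim_row (1\<^sub>m n)" "j < dim_col (1\<^sub>m n)"
    hence "(mat_adjoint W * W) $$ (i,j) =
       complex_of_real (1 / vec_norm2 (ws ! i)) * complex_of_real (1 / vec_norm2 (ws ! j)) * (ws ! j \<bullet>c ws ! i)"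
      using wsi[of i] wsi[of j]
      by (auto simp: W_def scalar_prod_def sum_distrib_left mult_ac sum_divide_distrib intro!: sum.cong)
    also have "\<dots> = 1\<^sub>m n $$ (i,j)"
      using ij ne[of i] corthogonalD[OF ws(2), of j i] ws(3) 
      by (auto simp: cscalar_prod_self power2_eq_square)
    finally show "(mat_adjoint W * W) $$ (i,j) = 1\<^sub>m n $$ (i,j)" .
  qed (auto simp: W_def)
  hence "unitary_mat n W" by (simp add: unitary_mat_def W_def)
  moreover have "col W 0 = complex_of_real (1 / vec_norm2 v) \<cdot>\<^sub>v v"
    using n v hd by (intro eq_vecI) (auto simp: W_def)
  ultimately show ?thesis using that by blast
qed

lemma unitary_similar:
  assumes "unitary_mat n W" "A \<in> carrier_mat n n"
  shows "similar_mat A (mat_adjoint W * A * W)"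
proof -
  note W = unitary_matD[OF assms(1)]
  have "W * (mat_adjoint W * A * W) * mat_adjoint W = (W * mat_adjoint W) * A * (W * mat_adjoint W)"
    using W(1) assms(2) by (simp add: assoc_mult_mat[of _ n n _ n _ n] mult_carrier_mat[of _ n n _ n])
  hence "similar_mat_wit A (mat_adjoint W * A * W) W (mat_adjoint W)"
    using W assms(2) by (intro similar_mat_witI[of _ _ n]) auto
  thus ?thesis unfolding similar_mat_def by blast
qed

section \<open>The spectral theorem for Hermitian matrices\<close>

text \<open>The eigenvalues may be listed in any order, which is what allows them to be sorted later on.
  The proof is deflation: rotate an eigenvector of the first eigenvalue into the first coordinate
  axis. The first column of the rotated matrix is then a multiple of the first unit vector, and so
  is its first row by symmetry, so the remaining block is a smaller Hermitian matrix that carries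
  the remaining eigenvalues.\<close>

theorem hermitian_spectral:
  fixes A :: "complex mat"
  assumes "A \<in> carrier_mat n n" "mat_adjoint A = A" "char_poly A = (\<Prod>e\<leftarrow>es. [:- e, 1:])"
  shows "\<exists>U. unitary_mat n U \<and> mat_adjoint U * A * U = mat_diag n (\<lambda>i. es ! i)"
  using assms
proof (induction es arbitrary: n A)
  case Nil
  hence "n = 0" using degree_monic_char_poly[of A n] by simp
  thus ?case using Nil by (intro exI[of _ "1\<^sub>m 0"]) (auto simp: unitary_mat_def mat_diag_def intro!: eq_matI)
next
  case (Cons e es n A)
  note A = Cons.prems(1) and herm = Cons.prems(2) and cp = Cons.prems(3)
  have "eigenvalue A e" using eigenvalue_root_char_poly[OF A] cp by simp
  then obtain v where v: "v \<in> carrier_vec n" "v \<noteq> 0\<^sub>v n" "A *\<^sub>v v = e \<cdot>\<^sub>v v"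
    using A by (auto simp: eigenvalue_def eigenvector_def)
  obtain W c where W: "unitary_mat n W" and Wc: "col W 0 = c \<cdot>\<^sub>v v" using unitary_completion[OF v(1,2)] .
  note WD = unitary_matD[OF W]
  obtain m where n: "n = Suc m" using v by (cases n) auto
  define A' where "A' = mat_adjoint W * A * W"
  have A': "A' \<in> carrier_mat n n" using WD(1) A by (simp add: A'_def mult_carrier_mat[of _ n n _ n])
  have herm': "mat_adjoint A' = A'"
    using WD(1) A herm by (simp add: A'_def mat_adjoint_mult[of _ n n _ n] assoc_mult_mat[of _ n n _ n _ n] mult_carrier_mat[of _ n n _ n])
  have cW: "col W 0 \<in> carrier_vec n" using v by (simp add: Wc)
  have "col A' 0 = mat_adjoint W * A *\<^sub>v col W 0"
    unfolding A'_def using WD(1) A n by (intro col_mult2[of _ n n _ n]) auto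
  also have "\<dots> = mat_adjoint W *\<^sub>v (A *\<^sub>v col W 0)"
    using WD(1) A cW by (intro assoc_mult_mat_vec[of _ n n _ n]) auto
  also have "A *\<^sub>v col W 0 = e \<cdot>\<^sub>v col W 0"
    unfolding Wc using v A by (simp add: mult_mat_vec[of _ n n] smult_smult_assoc mult.commute)
  also have "mat_adjoint W *\<^sub>v (e \<cdot>\<^sub>v col W 0) = e \<cdot>\<^sub>v (mat_adjoint W *\<^sub>v col W 0)"
    using WD(1) cW by (intro mult_mat_vec[of _ n n]) auto
  also have "mat_adjoint W *\<^sub>v col W 0 = col (mat_adjoint W * W) 0"
    using WD(1) n by (intro col_mult2[of _ n n _ n, symmetric]) auto
  finally have col0: "col A' 0 = e \<cdot>\<^sub>v unit_vec n 0" using WD(2) n by simp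
  have A'i0: "A' $$ (i, 0) = (if i = 0 then e else 0)" if "i < n" for i
    using arg_cong[OF col0, of "\<lambda>v. v $ i"] that A' n by (simp add: unit_vec_def)
  have A'0i: "A' $$ (0, i) = (if i = 0 then e else 0)" if "i < n" for i
  proof (cases "i = 0")
    case False
    have "A' $$ (0, i) = conjugate (A' $$ (i, 0))"
      using that A' n by (subst herm'[symmetric], subst mat_adjoint_index) auto
    thus ?thesis using A'i0[OF that] False by simp
  qed (use A'i0[OF that] in simp)
  define B where "B = mat m m (\<lambda>(i,j). A' $$ (Suc i, Suc j))"
  have B: "B \<in> carrier_mat m m" by (simp add: B_def)
  have block: "A' = four_block_mat (mat 1 1 (\<lambda>_. e)) (0\<^sub>m 1 m) (0\<^sub>m m 1) B"
    using A' A'0i A'i0 n by (intro eq_matI) (auto simp: B_def)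
  have hermB: "mat_adjoint B = B"
  proof (rule eq_matI)
    fix i j assume "i < dim_row B" "j < dim_col B"
    thus "mat_adjoint B $$ (i,j) = B $$ (i,j)"
      using arg_cong[OF herm', of "\<lambda>M. M $$ (Suc i, Suc j)"] A' n by (simp add: B_def)
  qed (auto simp: B_def)
  have "[:- e, 1:] * (\<Prod>e\<leftarrow>es. [:- e, 1:]) = char_poly A'"
    using char_poly_similar[OF unitary_similar[OF W A]] cp by (simp add: A'_def)
  also have "\<dots> = char_poly (mat 1 1 (\<lambda>_. e)) * char_poly B"
    unfolding block by (rule char_poly_four_block_zeros_col) (use B in auto)
  also have "char_poly (mat 1 1 (\<lambda>_. e)) = [:- e, 1:]"
    by (simp add: char_poly_defs det_def sign_def)
  finally have "char_poly B = (\<Prod>e\<leftarrow>es. [:- e, 1:])"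
    by (metis mult_cancel_left pCons_eq_0_iff zero_neq_one)
  from Cons.IH[OF B hermB this] obtain U where U: "unitary_mat m U"
    and D: "mat_adjoint U * B * U = mat_diag m (\<lambda>i. es ! i)" by blast
  note UD = unitary_matD[OF U]
  define V where "V = four_block_mat (1\<^sub>m 1) (0\<^sub>m 1 m) (0\<^sub>m m 1) U"
  have V: "V \<in> carrier_mat n n" using UD(1) n by (auto simp: V_def)
  have Vadj: "mat_adjoint V = four_block_mat (1\<^sub>m 1) (0\<^sub>m 1 m) (0\<^sub>m m 1) (mat_adjoint U)"
    using UD(1) V n by (intro eq_matI) (auto simp: V_def)
  have "mat_adjoint V * V = 1\<^sub>m n"
    unfolding Vadj unfolding V_def using UD n
    by (subst mult_four_block_mat[of _ 1 1 _ m _ m _ _ 1 _ m]) (auto simp: four_block_one_mat)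
  hence unV: "unitary_mat n V" using V by (simp add: unitary_mat_def)
  have "mat_adjoint V * A' * V = 
     four_block_mat (mat 1 1 (\<lambda>_. e)) (0\<^sub>m 1 m) (0\<^sub>m m 1) (mat_adjoint U * B * U)"
    unfolding Vadj block unfolding V_def using UD(1) B
    by (simp add: mult_carrier_mat[of _ m m _ m] mult_four_block_mat[of _ 1 1 _ m _ m _ _ 1 _ m])
  also have "\<dots> = mat_diag n (\<lambda>i. (e # es) ! i)"
    unfolding D using n by (intro eq_matI) (auto simp: mat_diag_def)
  also have "mat_adjoint V * A' * V = mat_adjoint (W * V) * A * (W * V)"
    using WD(1) V A by (simp add: A'_def mat_adjoint_mult[of _ n n _ n] assoc_mult_mat[of _ n n _ n _ n] mult_carrier_mat[of _ n n _ n])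
  finally show ?case using unitary_mat_mult[OF W unV] by blast
qed

section \<open>A lower bound for singular values\<close>

text \<open>A singular value decomposition without its left factor: \<open>A * U\<close> has orthogonal columns, and
  \<open>es\<close> lists their squared norms in the order of the singular values.\<close>

lemma sing_vals_decomposition:
  assumes A: "A \<in> carrier_mat m n"
  obtains es U where "map (\<lambda>z. sqrt (Re z)) es = sing_vals A" "length es = n" "unitary_mat n U"
    "mat_adjoint (A * U) * (A * U) = mat_diag n (\<lambda>i. es ! i)"
proof -
  define G where "G = mat_adjoint A * A"
  have G: "G \<in> carrier_mat n n" using A by (simp add: G_def mult_carrier_mat[of _ n m _ n])
  have herm: "mat_adjoint G = G" using A by (simp add: G_def mat_adjoint_mult[of _ n m _ n])
  obtain xs where xs: "mset xs = proots (char_poly G)" using ex_mset by blast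
  define f :: "complex \<Rightarrow> real" where "f = (\<lambda>z. sqrt (Re z))"
  define es where "es = rev (sort_key f xs)"
  have mset_es: "mset es = proots (char_poly G)" by (simp add: es_def xs)
  have "sing_vals A = rev (sort (map f xs))"
    unfolding sing_vals_def G_def[symmetric] f_def[symmetric] xs[symmetric] mset_map[symmetric]
    by (simp only: sorted_list_of_multiset_mset)
  also have "sort (map f xs) = map f (sort_key f xs)"
    by (rule properties_for_sort) auto
  finally have sv: "map f es = sing_vals A" by (simp add: es_def rev_map)
  have "char_poly G = (\<Prod>x\<in>#mset es. [:-x, 1:])"
    using complex_poly_decompose_multiset[of "char_poly G"] degree_monic_char_poly[OF G]
    by (simp add: mset_es)
  also have "\<dots> = (\<Prod>e\<leftarrow>es. [:- e, 1:])"
    by (simp only: mset_map[symmetric] prod_mset_prod_list)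
  finally have cp: "char_poly G = (\<Prod>e\<leftarrow>es. [:- e, 1:])" .
  obtain U where U: "unitary_mat n U" "mat_adjoint U * G * U = mat_diag n (\<lambda>i. es ! i)"
    using hermitian_spectral[OF G herm cp] by blast
  have "length es = n"
    using size_proots_complex[of "char_poly G"] degree_monic_char_poly[OF G]
    by (simp add: mset_es[symmetric])
  moreover have "mat_adjoint (A * U) * (A * U) = mat_adjoint U * G * U"
    using A unitary_matD(1)[OF U(1)]
    by (simp add: G_def mat_adjoint_mult[of _ m n _ n] assoc_mult_mat[of _ n m _ n _ n]
        assoc_mult_mat[of _ n n _ m _ n] assoc_mult_mat[of _ n n _ n _ n] mult_carrier_mat[of _ m n _ n]
        mult_carrier_mat[of _ n m _ n])
  ultimately show ?thesis using that[of es U] U sv by (simp add: f_def)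
qed

lemma vec_norm2_mult_mat_vec_square:
  assumes "A \<in> carrier_mat m n" "x \<in> carrier_vec n"
  shows "complex_of_real ((vec_norm2 (A *\<^sub>v x))\<^sup>2) = x \<bullet>c (mat_adjoint A * A *\<^sub>v x)"
  using assms
  by (simp add: cscalar_prod_self[symmetric] cscalar_prod_adjoint[of A m n]
      mult_mat_vec_carrier[of _ m n] assoc_mult_mat_vec[of _ n m _ n] del: of_real_power)

lemma adjoint_mult_self_diag:
  fixes C :: "complex mat"
  assumes "C \<in> carrier_mat m n" "i < n"
  shows "(mat_adjoint C * C) $$ (i, i) = complex_of_real (\<Sum>k<m. (cmod (C $$ (k, i)))\<^sup>2)"
  using assms by (simp add: scalar_prod_def atLeast0LessThan complex_norm_square mult.commute
      del: of_real_power)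

text \<open>There are \<open>r\<close> homogeneous equations in \<open>r + 1\<close> unknowns. Padding them with a zero row gives a
  square singular matrix.\<close>

lemma exists_kernel_vector_wide:
  fixes F :: "'a :: field mat"
  assumes F: "F \<in> carrier_mat n (r + 1)" and r: "r \<le> n"
  shows "\<exists>c \<in> carrier_vec (r + 1). c \<noteq> 0\<^sub>v (r + 1) \<and> (\<forall>i<r. (F *\<^sub>v c) $ i = 0)"
proof -
  define M where "M = mat (r + 1) (r + 1) (\<lambda>(i, j). if i < r then F $$ (i, j) else 0)"
  have M: "M \<in> carrier_mat (r + 1) (r + 1)" by (simp add: M_def)
  have "transpose_mat M *\<^sub>v unit_vec (r + 1) r = 0\<^sub>v (r + 1)"
    using F by (intro eq_vecI) (auto simp: M_def scalar_prod_right_unit)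
  hence "det (transpose_mat M) = 0"
    using M by (subst det_0_iff_vec_prod_zero[of _ "r + 1"])
      (auto intro!: exI[of _ "unit_vec (r + 1) r"] simp: unit_vec_nonzero)
  hence "det M = 0" using det_transpose[OF M] by simp
  then obtain c where c: "c \<in> carrier_vec (r + 1)" "c \<noteq> 0\<^sub>v (r + 1)" "M *\<^sub>v c = 0\<^sub>v (r + 1)"
    using det_0_iff_vec_prod_zero[OF M] by blast
  have "(F *\<^sub>v c) $ i = 0" if "i < r" for i
  proof -
    have "(F *\<^sub>v c) $ i = (M *\<^sub>v c) $ i"
      using that F r c(1) by (auto simp: M_def scalar_prod_def intro!: sum.cong)
    thus ?thesis using c(3) that by simp
  qed
  thus ?thesis using c by blast
qed

text \<open>The half of the Courant-Fischer principle that bounds a singular value from below, with the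
  test space given as the range of an injective matrix \<open>V\<close>. The range has dimension \<open>r + 1\<close>, so it
  contains a nonzero vector orthogonal to the first \<open>r\<close> right singular vectors, and \<open>A\<close> stretches
  that vector by at most the singular value number \<open>r + 1\<close>.\<close>

theorem sing_val_lower_bound:
  fixes A V :: "complex mat"
  assumes A: "A \<in> carrier_mat m n" and V: "V \<in> carrier_mat n (r + 1)" and r: "r < n"
    and inj: "\<And>c. c \<in> carrier_vec (r + 1) \<Longrightarrow> V *\<^sub>v c = 0\<^sub>v n \<Longrightarrow> c = 0\<^sub>v (r + 1)"
    and K: "K \<ge> 0"
    and bound: "\<And>c. c \<in> carrier_vec (r + 1) \<Longrightarrow>
      vec_norm2 (V *\<^sub>v c) \<le> K * vec_norm2 (A *\<^sub>v (V *\<^sub>v c))"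
  shows "1 \<le> K * sing_val (r + 1) A"
proof -
  obtain es U where es: "map (\<lambda>z. sqrt (Re z)) es = sing_vals A" "length es = n"
    and U: "unitary_mat n U" and D: "mat_adjoint (A * U) * (A * U) = mat_diag n (\<lambda>i. es ! i)"
    using sing_vals_decomposition[OF A] .
  note UD = unitary_matD[OF U]
  have AU: "A * U \<in> carrier_mat m n" using A UD by simp
  have es_real: "es ! i = complex_of_real (\<Sum>k<m. (cmod ((A * U) $$ (k, i)))\<^sup>2)" if "i < n" for i
    using adjoint_mult_self_diag[OF AU that] that by (simp only: D) (simp add: mat_diag_def)
  have es_nonneg: "0 \<le> Re (es ! i)" and es_Im: "complex_of_real (Re (es ! i)) = es ! i" if "i < n" for i
    using es_real[OF that] by (simp_all add: sum_nonneg)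
  define \<sigma> where "\<sigma> = sing_val (r + 1) A"
  have sv: "sing_vals A ! i = sqrt (Re (es ! i))" if "i < n" for i
    using es that by (metis nth_map)
  have \<sigma>: "\<sigma> = sqrt (Re (es ! r))" using r by (simp add: \<sigma>_def sing_val_def sv)
  have \<sigma>0: "0 \<le> \<sigma>" using es_nonneg[OF r] by (simp add: \<sigma>)
  have small: "Re (es ! i) \<le> \<sigma>\<^sup>2" if "r \<le> i" "i < n" for i
  proof -
    have "sing_vals A ! i \<le> sing_vals A ! r"
      using that arg_cong[OF es(1), of length]
      by (intro sorted_rev_nth_mono) (auto simp: sing_vals_def es(2))
    thus ?thesis using that r es_nonneg by (simp add: sv \<sigma>)
  qed
  have F: "mat_adjoint U * V \<in> carrier_mat n (r + 1)"
    using UD(1) V by (intro mult_carrier_mat[of _ n n]) auto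
  obtain c where c: "c \<in> carrier_vec (r + 1)" "c \<noteq> 0\<^sub>v (r + 1)"
    and zero: "\<And>i. i < r \<Longrightarrow> (mat_adjoint U * V *\<^sub>v c) $ i = 0"
    using exists_kernel_vector_wide[OF F] r by fastforce
  define y where "y = V *\<^sub>v c"
  \<comment> \<open>\<open>d\<close> holds the coordinates of \<open>y\<close> in the basis of right singular vectors.\<close>
  define d where "d = mat_adjoint U * V *\<^sub>v c"
  have y: "y \<in> carrier_vec n" using V c by (simp add: y_def)
  have d: "d \<in> carrier_vec n" using F c by (simp add: d_def)
  have "U *\<^sub>v d = (U * mat_adjoint U) *\<^sub>v (V *\<^sub>v c)"
    using UD(1) V c by (simp add: d_def assoc_mult_mat_vec[of _ n n _ "r + 1"] assoc_mult_mat_vec[of _ n n _ n]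
       mult_mat_vec_carrier[of _ n n] mult_mat_vec_carrier[of _ n "r + 1"])
  hence Ud: "U *\<^sub>v d = y" using UD(3) y by (simp add: y_def)
  have norm_y: "(vec_norm2 y)\<^sup>2 = (\<Sum>i<n. (cmod (d $ i))\<^sup>2)"
  proof -
    have "complex_of_real ((vec_norm2 y)\<^sup>2) = d \<bullet>c d"
      using vec_norm2_mult_mat_vec_square[OF UD(1) d] UD(2) d by (simp add: Ud)
    also have "d \<bullet>c d = complex_of_real ((vec_norm2 d)\<^sup>2)" by (rule cscalar_prod_self)
    finally have "(vec_norm2 y)\<^sup>2 = (vec_norm2 d)\<^sup>2" by (simp only: of_real_eq_iff)
    thus ?thesis using d by (simp add: vec_norm2_square)
  qed
  have "complex_of_real ((vec_norm2 (A *\<^sub>v y))\<^sup>2) = d \<bullet>c (mat_diag n (\<lambda>i. es ! i) *\<^sub>v d)"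
    using vec_norm2_mult_mat_vec_square[OF AU d] A UD(1) d
    by (simp add: D Ud assoc_mult_mat_vec[of _ m n _ n])
  also have "\<dots> = (\<Sum>i<n. d $ i * cnj (es ! i * d $ i))"
  proof -
    have "mat_diag n (\<lambda>i. es ! i) *\<^sub>v d = vec n (\<lambda>i. es ! i * d $ i)"
      using d by (intro eq_vecI)
        (auto simp: mat_diag_def scalar_prod_def if_distrib[of "\<lambda>x. x * _"] cong: if_cong)
    thus ?thesis using d by (simp add: scalar_prod_def atLeast0LessThan)
  qed
  also have "\<dots> = (\<Sum>i<n. complex_of_real (Re (es ! i) * (cmod (d $ i))\<^sup>2))"
  proof (rule sum.cong)
    fix i assume "i \<in> {..<n}"
    hence "cnj (es ! i) = complex_of_real (Re (es ! i))"
      using es_Im[of i] by (metis complex_cnj_complex_of_real lessThan_iff)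
    thus "d $ i * cnj (es ! i * d $ i) = complex_of_real (Re (es ! i) * (cmod (d $ i))\<^sup>2)"
      by (simp add: complex_norm_square mult_ac del: of_real_power)
  qed simp
  finally have norm_Ay: "(vec_norm2 (A *\<^sub>v y))\<^sup>2 = (\<Sum>i<n. Re (es ! i) * (cmod (d $ i))\<^sup>2)"
    by (simp only: of_real_eq_iff of_real_sum[symmetric])
  also have "\<dots> \<le> (\<Sum>i<n. \<sigma>\<^sup>2 * (cmod (d $ i))\<^sup>2)"
  proof (rule sum_mono)
    fix i assume i: "i \<in> {..<n}"
    show "Re (es ! i) * (cmod (d $ i))\<^sup>2 \<le> \<sigma>\<^sup>2 * (cmod (d $ i))\<^sup>2"
    proof (cases "i < r")
      case True
      thus ?thesis using zero by (simp add: d_def)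
    next
      case False
      thus ?thesis using small[of i] i by (intro mult_right_mono) auto
    qed
  qed
  also have "\<dots> = (\<sigma> * vec_norm2 y)\<^sup>2"
    by (simp add: norm_y power_mult_distrib sum_distrib_left)
  finally have "vec_norm2 (A *\<^sub>v y) \<le> \<sigma> * vec_norm2 y"
    using \<sigma>0 vec_norm2_nonneg by (meson mult_nonneg_nonneg power2_le_imp_le)
  hence "vec_norm2 y \<le> K * (\<sigma> * vec_norm2 y)"
    using bound[OF c(1)] K unfolding y_def[symmetric] by (meson mult_left_mono order_trans)
  moreover have "vec_norm2 y > 0"
    using inj[OF c(1)] c(2) vec_norm2_eq_0[OF y] vec_norm2_nonneg[of y] by (auto simp: y_def)
  ultimately have "1 \<le> K * \<sigma>" by (simp add: mult.assoc[symmetric])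
  thus ?thesis by (simp add: \<sigma>_def)
qed

section \<open>Spectral and Frobenius norm\<close>

lemma vec_norm2_le_frobenius:
  assumes "A \<in> carrier_mat m n" "x \<in> carrier_vec n"
  shows "vec_norm2 (A *\<^sub>v x) \<le> frobenius_norm A * vec_norm2 x"
proof -
  have entry: "(cmod ((A *\<^sub>v x) $ i))\<^sup>2 \<le> (\<Sum>j<n. (cmod (A $$ (i, j)))\<^sup>2) * (vec_norm2 x)\<^sup>2" if "i < m" for i
  proof -
    have "cmod ((A *\<^sub>v x) $ i) \<le> (\<Sum>j<n. cmod (A $$ (i, j)) * cmod (x $ j))"
      using assms that by (auto simp: scalar_prod_def atLeast0LessThan norm_mult[symmetric] intro: norm_sum)
    also have "\<dots> \<le> L2_set (\<lambda>j. cmod (A $$ (i, j))) {..<n} * L2_set (\<lambda>j. cmod (x $ j)) {..<n}"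
      using L2_set_mult_ineq[of "\<lambda>j. cmod (A $$ (i, j))" "\<lambda>j. cmod (x $ j)"] by simp
    finally have "(cmod ((A *\<^sub>v x) $ i))\<^sup>2
        \<le> (L2_set (\<lambda>j. cmod (A $$ (i, j))) {..<n} * L2_set (\<lambda>j. cmod (x $ j)) {..<n})\<^sup>2"
      by (rule power_mono) simp
    also have "\<dots> = (\<Sum>j<n. (cmod (A $$ (i, j)))\<^sup>2) * (\<Sum>j<n. (cmod (x $ j))\<^sup>2)"
      by (simp add: power_mult_distrib L2_set_def sum_nonneg)
    finally show ?thesis using assms by (simp add: vec_norm2_square)
  qed
  have "(vec_norm2 (A *\<^sub>v x))\<^sup>2 = (\<Sum>i<m. (cmod ((A *\<^sub>v x) $ i))\<^sup>2)"
    using assms by (simp add: vec_norm2_square)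
  also have "\<dots> \<le> (\<Sum>i<m. (\<Sum>j<n. (cmod (A $$ (i, j)))\<^sup>2) * (vec_norm2 x)\<^sup>2)"
    by (intro sum_mono entry) simp
  also have "\<dots> = (frobenius_norm A * vec_norm2 x)\<^sup>2"
    using assms by (simp add: frobenius_norm_def power_mult_distrib sum_nonneg sum_distrib_right)
  finally show ?thesis
    by (rule power2_le_imp_le) (simp add: frobenius_norm_def sum_nonneg vec_norm2_nonneg)
qed

lemma vec_norm2_smult: "vec_norm2 (c \<cdot>\<^sub>v x) = cmod c * vec_norm2 x"
  by (simp add: vec_norm2_def norm_mult power_mult_distrib real_sqrt_mult flip: sum_distrib_left)

lemma frobenius_norm_nonneg: "0 \<le> frobenius_norm A"
  by (simp add: frobenius_norm_def sum_nonneg)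

lemma vec_norm2_le_frobenius_unit:
  assumes "A \<in> carrier_mat m n" "x \<in> carrier_vec n" "vec_norm2 x \<le> 1"
  shows "vec_norm2 (A *\<^sub>v x) \<le> frobenius_norm A"
  using vec_norm2_le_frobenius[OF assms(1,2)] mult_left_mono[OF assms(3) frobenius_norm_nonneg[of A]]
  by simp

lemma vec_norm2_zero [simp]: "vec_norm2 (0\<^sub>v n) = 0"
  by (simp add: vec_norm2_def)

text \<open>The Frobenius norm bounds the set whose supremum is the spectral norm, without which
  the supremum would carry no information.\<close>

lemma spectral_norm_upper:
  assumes "A \<in> carrier_mat m n" "x \<in> carrier_vec n" "vec_norm2 x \<le> 1"
  shows "vec_norm2 (A *\<^sub>v x) \<le> spectral_norm A"
  unfolding spectral_norm_def
proof (rule cSUP_upper)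
  show "bdd_above ((\<lambda>x. vec_norm2 (A *\<^sub>v x)) ` {x \<in> carrier_vec (dim_col A). vec_norm2 x \<le> 1})"
    using vec_norm2_le_frobenius_unit[OF assms(1)] assms(1)
    by (intro bdd_aboveI[where M = "frobenius_norm A"]) auto
qed (use assms in auto)

lemma spectral_norm_nonneg: "0 \<le> spectral_norm A"
  using order_trans[OF vec_norm2_nonneg spectral_norm_upper[of A "dim_row A" "dim_col A" "0\<^sub>v (dim_col A)"]]
  by simp

lemma spectral_norm_le_frobenius: "spectral_norm A \<le> frobenius_norm A"
  unfolding spectral_norm_def
proof (rule cSUP_least)
  have "0\<^sub>v (dim_col A) \<in> {x \<in> carrier_vec (dim_col A). vec_norm2 x \<le> 1}" by simp
  thus "{x \<in> carrier_vec (dim_col A). vec_norm2 x \<le> 1} \<noteq> {}" by blast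
qed (auto intro: vec_norm2_le_frobenius_unit[of A "dim_row A" "dim_col A"])

lemma vec_norm2_le_spectral:
  assumes A: "A \<in> carrier_mat m n" and x: "x \<in> carrier_vec n"
  shows "vec_norm2 (A *\<^sub>v x) \<le> spectral_norm A * vec_norm2 x"
proof (cases "x = 0\<^sub>v n")
  case True
  thus ?thesis using vec_norm2_le_frobenius[OF A x] by (simp add: vec_norm2_def)
next
  case False
  define c where "c = vec_norm2 x"
  have c: "c > 0" using False vec_norm2_eq_0[OF x] vec_norm2_nonneg[of x] by (auto simp: c_def)
  define u where "u = complex_of_real (1 / c) \<cdot>\<^sub>v x"
  have u: "u \<in> carrier_vec n" "vec_norm2 u = 1" using x c
    by (auto simp: u_def vec_norm2_smult norm_divide c_def)
  have "vec_norm2 (A *\<^sub>v u) \<le> spectral_norm A"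
    using spectral_norm_upper[OF A u(1)] u(2) by simp
  also have "A *\<^sub>v u = complex_of_real (1 / c) \<cdot>\<^sub>v (A *\<^sub>v x)"
    unfolding u_def by (rule mult_mat_vec[OF A x])
  finally show ?thesis using c by (simp add: vec_norm2_smult norm_divide divide_le_eq c_def)
qed

section \<open>Vectors and matrices in blocks\<close>

lemma sum_blocks: "(\<Sum>b<k * n. f b) = (\<Sum>j<k. \<Sum>q<n. f (j * n + q :: nat))"
proof -
  have "(\<Sum>b<k * n. f b) = (\<Sum>j<k. sum f {j * n..<j * n + n})"
    by (simp add: sum.nat_group)
  moreover have "sum f {j * n..<j * n + n} = (\<Sum>q<n. f (j * n + q))" for j
    using sum.shift_bounds_nat_ivl[of f 0 "j * n" n] by (simp add: atLeast0LessThan add.commute)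
  ultimately show ?thesis by simp
qed

lemma block_index_less:
  fixes i q m n :: nat
  assumes "i < m" "q < n"
  shows "i * n + q < m * n"
proof -
  have "i * n + q < Suc i * n" using assms by simp
  also have "\<dots> \<le> m * n" using assms by (intro mult_right_mono) auto
  finally show ?thesis .
qed

lemma block_indexE:
  fixes a m n :: nat
  assumes "a < m * n"
  obtains i q where "i < m" "q < n" "a = i * n + q"
proof -
  have "0 < n" using assms by (cases n) auto
  thus ?thesis using that[of "a div n" "a mod n"] assms by (simp add: less_mult_imp_div_less)
qed

lemma vec_norm2_square_blocks:
  assumes "v \<in> carrier_vec (m * n)"
  shows "(vec_norm2 v)\<^sup>2 = (\<Sum>i<m. (vec_norm2 (vec n (\<lambda>q. v $ (i * n + q))))\<^sup>2)"
  using assms by (simp add: vec_norm2_square sum_blocks)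

text \<open>In block form \<open>v = - (I \<otimes> C) u\<close>, and the spectral norm of \<open>I \<otimes> C\<close> is at most that of \<open>C\<close>.\<close>

lemma vec_norm2_le_blockwise:
  assumes C: "C \<in> carrier_mat n L" and v: "v \<in> carrier_vec (m * n)" and u: "u \<in> carrier_vec (m * L)"
    and blk: "\<And>i. i < m \<Longrightarrow> vec n (\<lambda>p. v $ (i * n + p)) = - (C *\<^sub>v vec L (\<lambda>b. u $ (i * L + b)))"
  shows "vec_norm2 v \<le> spectral_norm C * vec_norm2 u"
proof -
  have "(vec_norm2 v)\<^sup>2 = (\<Sum>i<m. (vec_norm2 (C *\<^sub>v vec L (\<lambda>b. u $ (i * L + b))))\<^sup>2)"
    by (simp add: vec_norm2_square_blocks[OF v] blk) (simp add: vec_norm2_def)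
  also have "\<dots> \<le> (\<Sum>i<m. (spectral_norm C * vec_norm2 (vec L (\<lambda>b. u $ (i * L + b))))\<^sup>2)"
    by (intro sum_mono power_mono vec_norm2_le_spectral[OF C] vec_norm2_nonneg) auto
  also have "\<dots> = (spectral_norm C * vec_norm2 u)\<^sup>2"
    by (simp add: power_mult_distrib vec_norm2_square_blocks[OF u] sum_distrib_left)
  finally show ?thesis
    by (rule power2_le_imp_le) (simp add: spectral_norm_nonneg vec_norm2_nonneg)
qed

lemma frobenius_norm_coeff_row:
  assumes "\<forall>i\<le>k. A i \<in> carrier_mat n n"
  shows "(frobenius_norm (coeff_row n k A))\<^sup>2 = (\<Sum>i\<le>k. (frobenius_norm (A i))\<^sup>2)"
proof -
  have "(frobenius_norm (coeff_row n k A))\<^sup>2 = 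
     (\<Sum>a<n. \<Sum>c<(k + 1) * n. (cmod (coeff_row n k A $$ (a, c)))\<^sup>2)"
    by (simp add: frobenius_norm_def sum_nonneg) (simp add: coeff_row_def)
  also have "\<dots> = (\<Sum>a<n. \<Sum>i<k + 1. \<Sum>b<n. (cmod (coeff_row n k A $$ (a, i * n + b)))\<^sup>2)"
    by (simp only: sum_blocks)
  also have "\<dots> = (\<Sum>a<n. \<Sum>i<k + 1. \<Sum>b<n. (cmod (A i $$ (a, b)))\<^sup>2)"
    by (intro sum.cong refl) (use block_index_less[of _ "k + 1" _ n] in \<open>auto simp: coeff_row_def\<close>)
  also have "\<dots> = (\<Sum>i<k + 1. \<Sum>a<n. \<Sum>b<n. (cmod (A i $$ (a, b)))\<^sup>2)"
    by (rule sum.swap)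
  also have "\<dots> = (\<Sum>i\<le>k. (frobenius_norm (A i))\<^sup>2)"
    using assms by (intro sum.cong) (auto simp: frobenius_norm_def sum_nonneg)
  finally show ?thesis .
qed

lemma spectral_norm_le_tri_norm:
  assumes "\<forall>i\<le>k. A i \<in> carrier_mat n n"
  shows "spectral_norm (coeff_row n k A) \<le> tri_norm s n k A"
proof (cases s)
  case Frobenius
  have "tri_norm s n k A = frobenius_norm (coeff_row n k A)"
    using frobenius_norm_nonneg
    by (simp add: Frobenius frobenius_norm_coeff_row[OF assms, symmetric])
  thus ?thesis by (simp add: spectral_norm_le_frobenius)
qed simp

section \<open>Taylor expansion at a point\<close>

text \<open>The Taylor coefficients at \<open>z\<close> are the ordinary coefficients of the polynomial in the variable
  \<open>\<lambda> - z\<close>, so products of Taylor polynomials become products of polynomials.\<close>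

abbreviation taylor_shift :: "complex \<Rightarrow> complex poly \<Rightarrow> complex poly" where
  "taylor_shift z p \<equiv> p \<circ>\<^sub>p [:z, 1:]"

lemma coeff_taylor_shift:
  "coeff (taylor_shift z p) i = 1 / fact i * poly ((pderiv ^^ i) p) z"
proof -
  have "(pderiv ^^ i) (taylor_shift z p) = taylor_shift z ((pderiv ^^ i) p)"
    by (induction i) (simp_all add: pderiv_pcompose pderiv_pCons)
  hence "poly ((pderiv ^^ i) p) z = coeff ((pderiv ^^ i) (taylor_shift z p)) 0"
    by (simp add: poly_0_coeff_0[symmetric] poly_pcompose)
  also have "\<dots> = fact i * coeff (taylor_shift z p) i"
    by (simp add: coeff_higher_pderiv pochhammer_fact)
  finally show ?thesis by simp
qed

lemma coeff_0_taylor_shift: "coeff (taylor_shift z p) 0 = poly p z"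
  by (simp add: coeff_taylor_shift)

lemma taylor_shift_hom: "comm_ring_hom (taylor_shift z)"
  by unfold_locales (auto simp: pcompose_add pcompose_mult)

lemma coeff_taylor_shift_dvd:
  assumes "[:- z, 1:] ^ m dvd p" "i < m"
  shows "coeff (taylor_shift z p) i = 0"
proof -
  obtain g where "p = [:- z, 1:] ^ m * g" using assms(1) by (elim dvdE)
  moreover have "taylor_shift z ([:- z, 1:] ^ m) = monom 1 m"
    by (induction m) (simp_all only: power_Suc pcompose_mult, simp_all add: pcompose_pCons monom_Suc)
  ultimately have "taylor_shift z p = monom 1 m * taylor_shift z g"
    by (simp add: pcompose_mult)
  thus ?thesis using assms(2) by (simp add: coeff_monom_mult)
qed

lemma coeff_mult_low_zero:
  assumes "\<forall>i\<le>r. coeff g i = 0" "i \<le> r"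
  shows "coeff (f * g) i = 0"
  using assms by (simp add: coeff_mult)

text \<open>A polynomial with nonzero constant coefficient is a unit modulo every power of the variable.\<close>

lemma coeff_mult_low_zero_cancel:
  fixes f g :: "'a :: idom poly"
  assumes f0: "coeff f 0 \<noteq> 0" and fg: "\<forall>i\<le>r. coeff (f * g) i = 0"
  shows "i \<le> r \<Longrightarrow> coeff g i = 0"
proof (induction i rule: less_induct)
  case (less i)
  have "coeff (f * g) i = (\<Sum>j\<le>i. coeff f j * coeff g (i - j))" by (rule coeff_mult)
  also have "\<dots> = (\<Sum>j\<le>i. if j = 0 then coeff f 0 * coeff g i else 0)"
    by (intro sum.cong) (use less in auto)
  also have "\<dots> = coeff f 0 * coeff g i" by simp
  finally show ?case using f0 fg less.prems by simp
qed

section \<open>A Jordan chain from an elementary divisor\<close>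

text \<open>In the Smith form \<open>Q = E D F\<close> let \<open>d\<close> be the diagonal entry number \<open>i\<close> that contributes the
  elementary divisor, and let \<open>x\<close> be column \<open>i\<close> of the adjugate of \<open>F\<close>. Then \<open>F x\<close> is a nonzero
  constant times the unit vector number \<open>i\<close>. Hence \<open>x\<close> does not vanish at \<open>z\<close>, while
  \<open>Q x\<close> is a multiple of \<open>d\<close>. The Taylor coefficients of \<open>x\<close> at \<open>z\<close> form a Jordan chain.\<close>

lemma elementary_divisor_local_kernel:
  assumes "elementary_divisor n Q ([:- z, 1:] ^ j)" "1 \<le> j"
  obtains x where "Q \<in> carrier_mat n n" "x \<in> carrier_vec n" "\<exists>q<n. poly (x $ q) z \<noteq> 0"
    "\<And>p. p < n \<Longrightarrow> [:- z, 1:] ^ j dvd (Q *\<^sub>v x) $ p"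
proof -
  from assms(1) obtain ds d S c where smith: "is_smith_form n Q ds" and d: "d \<in> set ds"
    and S: "finite S" "d = (\<Prod>w\<in>S. [:-w, 1:] ^ c w)" "\<exists>w\<in>S. [:- z, 1:] ^ j = [:-w, 1:] ^ c w"
    unfolding elementary_divisor_def by blast
  have dvd_d: "[:- z, 1:] ^ j dvd d" using S by (metis dvd_prodI)
  obtain i where i: "i < length ds" "ds ! i = d" using d by (metis in_set_conv_nth)
  define D where "D = mat_diag n (\<lambda>i. if i < length ds then ds ! i else 0)"
  obtain E F where E: "unimodular_mat_poly n E" and F: "unimodular_mat_poly n F" and Q: "Q = E * D * F"
    and len: "length ds \<le> n"
    using smith unfolding is_smith_form_def D_def by blast
  have in_n: "i < n" using i len by simp
  have Ec: "E \<in> carrier_mat n n" and Fc: "F \<in> carrier_mat n n" and D: "D \<in> carrier_mat n n"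
    using E F by (auto simp: unimodular_mat_poly_def D_def)
  obtain e where e: "e \<noteq> 0" "det F = [:e:]" using F by (auto simp: unimodular_mat_poly_def)
  define x where "x = adj_mat F *\<^sub>v unit_vec n i"
  have x: "x \<in> carrier_vec n" using adj_mat(1)[OF Fc] by (simp add: x_def)
  have Fx: "F *\<^sub>v x = [:e:] \<cdot>\<^sub>v unit_vec n i"
  proof -
    have "F *\<^sub>v x = (F * adj_mat F) *\<^sub>v unit_vec n i"
      using adj_mat(1)[OF Fc] Fc by (simp add: x_def assoc_mult_mat_vec[of _ n n _ n])
    also have "\<dots> = [:e:] \<cdot>\<^sub>v unit_vec n i"
      using adj_mat(2)[OF Fc] in_n e(2) by (intro eq_vecI) (auto simp: scalar_prod_right_unit)
    finally show ?thesis .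
  qed
  have Qx: "Q *\<^sub>v x = E *\<^sub>v (D *\<^sub>v ([:e:] \<cdot>\<^sub>v unit_vec n i))"
    using Ec Fc D x
    by (simp add: Q Fx[symmetric] assoc_mult_mat_vec[of _ n n _ n] mult_carrier_mat[of _ n n _ n]
        mult_mat_vec_carrier[of _ n n])
  also have "D *\<^sub>v ([:e:] \<cdot>\<^sub>v unit_vec n i) = (d * [:e:]) \<cdot>\<^sub>v unit_vec n i"
    using in_n i by (intro eq_vecI) (auto simp: D_def mat_diag_def)
  also have "E *\<^sub>v \<dots> = (d * [:e:]) \<cdot>\<^sub>v (E *\<^sub>v unit_vec n i)"
    using Ec by (intro eq_vecI) auto
  finally have "[:- z, 1:] ^ j dvd (Q *\<^sub>v x) $ p" if "p < n" for p
    using dvd_d that Ec by (simp add: dvd_smult)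
  moreover have "\<exists>q<n. poly (x $ q) z \<noteq> 0"
  proof (rule ccontr)
    assume "\<not> ?thesis"
    hence zero: "poly (x $ q) z = 0" if "q < n" for q using that by blast
    have "e = poly ((F *\<^sub>v x) $ i) z" using in_n by (simp add: Fx)
    also have "\<dots> = 0"
      using in_n Fc x zero by (simp add: scalar_prod_def poly_sum)
    finally show False using e(1) by simp
  qed
  moreover have "Q \<in> carrier_mat n n" using Ec Fc D by (simp add: Q mult_carrier_mat[of _ n n _ n])
  ultimately show ?thesis using that x by blast
qed

section \<open>The block Toeplitz matrix\<close>

text \<open>Component \<open>p\<close> of the product of the matrix polynomial \<open>P\<close> with a vector polynomial, both
  expanded at \<open>z\<close>; \<open>y\<close> is already given in the variable \<open>\<lambda> - z\<close>.\<close>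

definition shifted_row_sum :: "nat \<Rightarrow> complex \<Rightarrow> complex poly mat \<Rightarrow> (nat \<Rightarrow> complex poly) \<Rightarrow> nat \<Rightarrow> complex poly" where
  "shifted_row_sum n z P y p = (\<Sum>q<n. taylor_shift z (P $$ (p, q)) * y q)"

lemma toeplitz_carrier [simp]: "toeplitz n r P z \<in> carrier_mat ((r + 1) * n) ((r + 1) * n)"
  by (simp add: toeplitz_def)

text \<open>A block Toeplitz matrix of Taylor coefficients acts on a vector of Taylor coefficients as
  multiplication of polynomials, truncated after degree \<open>r\<close>.\<close>

lemma toeplitz_mult_vec:
  assumes P: "P \<in> carrier_mat n n"
    and w: "w \<in> carrier_vec ((r + 1) * n)" "\<And>j q. j < r + 1 \<Longrightarrow> q < n \<Longrightarrow> w $ (j * n + q) = coeff (y q) j"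
    and ip: "i < r + 1" "p < n"
  shows "(toeplitz n r P z *\<^sub>v w) $ (i * n + p) = coeff (shifted_row_sum n z P y p) i"
proof -
  let ?N = "(r + 1) * n"
  have "(toeplitz n r P z *\<^sub>v w) $ (i * n + p) = (\<Sum>b<?N. toeplitz n r P z $$ (i * n + p, b) * w $ b)"
    using block_index_less[OF ip] w(1) toeplitz_carrier[of n r P z]
    by (simp add: scalar_prod_def atLeast0LessThan del: toeplitz_carrier)
  also have "\<dots> = (\<Sum>j<r + 1. \<Sum>q<n. toeplitz n r P z $$ (i * n + p, j * n + q) * w $ (j * n + q))"
    by (rule sum_blocks)
  also have "\<dots> = (\<Sum>j<r + 1. \<Sum>q<n. if j \<le> i then coeff (taylor_shift z (P $$ (p, q))) (i - j) * coeff (y q) j else 0)"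
  proof (intro sum.cong refl)
    fix j q assume "j \<in> {..<r + 1}" "q \<in> {..<n}"
    thus "toeplitz n r P z $$ (i * n + p, j * n + q) * w $ (j * n + q) =
       (if j \<le> i then coeff (taylor_shift z (P $$ (p, q))) (i - j) * coeff (y q) j else 0)"
      using ip P w(2)[of j q] block_index_less[of j "r + 1" q n] block_index_less[OF ip]
      by (simp add: toeplitz_def Let_def mat_poly_deriv_at_def coeff_taylor_shift)
  qed
  also have "\<dots> = (\<Sum>q<n. \<Sum>j<r + 1. if j \<le> i then coeff (taylor_shift z (P $$ (p, q))) (i - j) * coeff (y q) j else 0)"
    by (rule sum.swap)
  also have "\<dots> = (\<Sum>q<n. \<Sum>j\<le>i. coeff (taylor_shift z (P $$ (p, q))) (i - j) * coeff (y q) j)"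
    using ip(1) by (intro sum.cong refl sum.mono_neutral_cong_right) auto
  also have "\<dots> = (\<Sum>q<n. coeff (taylor_shift z (P $$ (p, q)) * y q) i)"
    by (simp add: mult.commute[of "taylor_shift _ _"] coeff_mult) (simp add: mult.commute)
  also have "\<dots> = coeff (shifted_row_sum n z P y p) i"
    by (simp add: shifted_row_sum_def coeff_sum)
  finally show ?thesis .
qed

lemma block_vec_eqI:
  assumes "v \<in> carrier_vec (m * n)" "w \<in> carrier_vec (m * n)"
    "\<And>i q. i < m \<Longrightarrow> q < n \<Longrightarrow> v $ (i * n + q) = w $ (i * n + q)"
  shows "v = w"
  using assms by (intro eq_vecI) (auto elim!: block_indexE)

text \<open>If the truncated product \<open>P y\<close> vanishes, then multiplying by the adjugate of \<open>P\<close> shows that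
  \<open>det P * y\<close> vanishes up to degree \<open>r\<close>. Since \<open>det P\<close> does not vanish at \<open>z\<close>, it can be cancelled.\<close>

lemma toeplitz_det_nonzero:
  assumes P: "P \<in> carrier_mat n n" and z: "poly (det P) z \<noteq> 0"
  shows "det (toeplitz n r P z) \<noteq> 0"
proof
  let ?N = "(r + 1) * n"
  assume "det (toeplitz n r P z) = 0"
  then obtain w where w: "w \<in> carrier_vec ?N" "w \<noteq> 0\<^sub>v ?N" "toeplitz n r P z *\<^sub>v w = 0\<^sub>v ?N"
    using det_0_iff_vec_prod_zero[OF toeplitz_carrier] by blast
  define y where "y q = (\<Sum>j<r + 1. monom (w $ (j * n + q)) j)" for q
  have y: "w $ (j * n + q) = coeff (y q) j" if "j < r + 1" for j q
    using that by (simp add: y_def coeff_sum sum.delta del: lessThan_Suc add_Suc_right Suc_eq_plus1)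
  interpret comm_ring_hom "taylor_shift z" by (rule taylor_shift_hom)
  define P' where "P' = map_mat (taylor_shift z) P"
  have P': "P' \<in> carrier_mat n n" using P by (simp add: P'_def)
  define Y where "Y = vec n y"
  have Y: "Y \<in> carrier_vec n" by (simp add: Y_def)
  have low: "coeff ((P' *\<^sub>v Y) $ p) i = 0" if "i \<le> r" "p < n" for i p
  proof -
    have "(P' *\<^sub>v Y) $ p = shifted_row_sum n z P y p"
      using that P by (simp add: P'_def Y_def shifted_row_sum_def scalar_prod_def atLeast0LessThan)
    hence "coeff ((P' *\<^sub>v Y) $ p) i = (toeplitz n r P z *\<^sub>v w) $ (i * n + p)"
      using that by (subst toeplitz_mult_vec[OF P w(1) y]) auto
    thus ?thesis using w(3) block_index_less[of i "r + 1" p n] that by simp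
  qed
  have "coeff (y q) i = 0" if q: "q < n" and i: "i \<le> r" for i q
  proof (rule coeff_mult_low_zero_cancel[of "det P'" r])
    show "coeff (det P') 0 \<noteq> 0" using z by (simp only: P'_def comm_ring_hom.hom_det[OF taylor_shift_hom] coeff_0_taylor_shift) simp
    have "det P' * y q = ((det P' \<cdot>\<^sub>m 1\<^sub>m n) *\<^sub>v Y) $ q"
      using q by (simp add: Y_def)
    also have "\<dots> = (adj_mat P' *\<^sub>v (P' *\<^sub>v Y)) $ q"
      unfolding adj_mat(3)[OF P', symmetric]
      by (simp only: assoc_mult_mat_vec[OF adj_mat(1)[OF P'] P' Y])
    also have "\<dots> = (\<Sum>p<n. adj_mat P' $$ (q, p) * (P' *\<^sub>v Y) $ p)"
      using q adj_mat(1)[OF P'] P' by (simp add: scalar_prod_def atLeast0LessThan)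
    finally show "\<forall>i\<le>r. coeff (det P' * y q) i = 0"
      using low by (auto simp: coeff_sum intro!: sum.neutral coeff_mult_low_zero[of r])
  qed (use i in auto)
  hence "w = 0\<^sub>v ?N"
    using w(1) y block_index_less[of _ "r + 1" _ n] by (intro block_vec_eqI[of _ "r + 1" n]) auto
  thus False using w(2) by simp
qed

lemma mat_inv:
  assumes A: "(A :: 'a :: field mat) \<in> carrier_mat n n" and "det A \<noteq> 0"
  shows "mat_inv A \<in> carrier_mat n n" "A * mat_inv A = 1\<^sub>m n" "mat_inv A * A = 1\<^sub>m n"
proof -
  have "A \<in> Units (ring_mat TYPE('a) n ())" using det_non_zero_imp_unit[OF assms] .
  then obtain B where "mat_inverse A = Some B"
    using mat_inverse(1)[OF A, where b = "()"] by (cases "mat_inverse A") auto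
  with mat_inverse(2)[OF A this]
  show "mat_inv A \<in> carrier_mat n n" "A * mat_inv A = 1\<^sub>m n" "mat_inv A * A = 1\<^sub>m n"
    by (auto simp: mat_inv_def)
qed

section \<open>Kronecker products\<close>

lemma kron_carrier [simp]:
  "A \<in> carrier_mat m k \<Longrightarrow> B \<in> carrier_mat p q \<Longrightarrow> kron A B \<in> carrier_mat (m * p) (k * q)"
  by (auto simp: kron_def)

lemma kron_index:
  assumes "A \<in> carrier_mat m k" "B \<in> carrier_mat p q" "a < m" "c < p" "b < k" "d < q"
  shows "kron A B $$ (a * p + c, b * q + d) = A $$ (a, b) * B $$ (c, d)"
  using assms block_index_less[of a m c p] block_index_less[of b k d q] by (auto simp: kron_def)

lemma eq_mat_blocksI:
  assumes "A \<in> carrier_mat (m * p) (k * q)" "B \<in> carrier_mat (m * p) (k * q)"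
    "\<And>a c b d. a < m \<Longrightarrow> c < p \<Longrightarrow> b < k \<Longrightarrow> d < q \<Longrightarrow>
       A $$ (a * p + c, b * q + d) = B $$ (a * p + c, b * q + d)"
  shows "A = B"
proof (rule eq_matI)
  fix i j assume "i < dim_row B" "j < dim_col B"
  hence "i < m * p" "j < k * q" using assms(2) by auto
  thus "A $$ (i, j) = B $$ (i, j)" using assms(3) by (metis block_indexE)
qed (use assms in auto)

lemma mult_mat_index:
  assumes "A \<in> carrier_mat m k" "B \<in> carrier_mat k q" "i < m" "j < q"
  shows "(A * B) $$ (i, j) = (\<Sum>c<k. A $$ (i, c) * B $$ (c, j))"
  using assms by (simp add: scalar_prod_def atLeast0LessThan)

lemma mult_mat_vec_index:
  assumes "A \<in> carrier_mat m k" "w \<in> carrier_vec k" "i < m"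
  shows "(A *\<^sub>v w) $ i = (\<Sum>c<k. A $$ (i, c) * w $ c)"
  using assms by (simp add: scalar_prod_def atLeast0LessThan)

lemma kron_mult:
  fixes A B C D :: "'a :: comm_semiring_1 mat"
  assumes A: "A \<in> carrier_mat m k" and C: "C \<in> carrier_mat k l"
    and B: "B \<in> carrier_mat p q" and D: "D \<in> carrier_mat q s"
  shows "kron A B * kron C D = kron (A * C) (B * D)"
proof (rule eq_mat_blocksI[of _ m p l s])
  fix a c b d assume abcd: "a < m" "c < p" "b < l" "d < s"
  have "(kron A B * kron C D) $$ (a * p + c, b * s + d) =
      (\<Sum>x<k * q. kron A B $$ (a * p + c, x) * kron C D $$ (x, b * s + d))"
    using abcd by (intro mult_mat_index[OF kron_carrier[OF A B] kron_carrier[OF C D]] block_index_less)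
  also have "\<dots> = (\<Sum>i<k. \<Sum>j<q. (A $$ (a, i) * C $$ (i, b)) * (B $$ (c, j) * D $$ (j, d)))"
    unfolding sum_blocks
    by (intro sum.cong refl) (use abcd in \<open>simp add: kron_index[OF A B] kron_index[OF C D] mult_ac\<close>)
  also have "\<dots> = kron (A * C) (B * D) $$ (a * p + c, b * s + d)"
    using abcd by (simp add: kron_index[OF mult_carrier_mat[OF A C] mult_carrier_mat[OF B D]]
        mult_mat_index[OF A C] mult_mat_index[OF B D] sum_product del: index_mult_mat)
  finally show "(kron A B * kron C D) $$ (a * p + c, b * s + d) = kron (A * C) (B * D) $$ (a * p + c, b * s + d)" .
qed (rule mult_carrier_mat[OF kron_carrier[OF A B] kron_carrier[OF C D]],
     rule kron_carrier[OF mult_carrier_mat[OF A C] mult_carrier_mat[OF B D]])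

lemma kron_adjoint:
  fixes A B :: "complex mat"
  assumes A: "A \<in> carrier_mat m k" and B: "B \<in> carrier_mat p q"
  shows "mat_adjoint (kron A B) = kron (mat_adjoint A) (mat_adjoint B)"
proof (rule eq_mat_blocksI[of _ k q m p])
  fix a c b d assume abcd: "a < k" "c < q" "b < m" "d < p"
  have "mat_adjoint (kron A B) $$ (a * q + c, b * p + d) = cnj (kron A B $$ (b * p + d, a * q + c))"
    using abcd block_index_less[of a k c q] block_index_less[of b m d p] kron_carrier[OF A B]
    by (subst mat_adjoint_index) auto
  thus "mat_adjoint (kron A B) $$ (a * q + c, b * p + d) = kron (mat_adjoint A) (mat_adjoint B) $$ (a * q + c, b * p + d)"
    using abcd A B by (simp add: kron_index[OF A B]
        kron_index[OF mat_adjoint_carrier[OF A] mat_adjoint_carrier[OF B]])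
qed (use assms in auto)

lemma kron_one_one: "kron (1\<^sub>m m) (1\<^sub>m n) = (1\<^sub>m (m * n) :: 'a :: semiring_1 mat)"
proof (rule eq_mat_blocksI[of _ m n m n])
  fix a c b d assume abcd: "a < m" "c < n" "b < m" "d < n"
  have "a * n + c = b * n + d \<longleftrightarrow> a = b \<and> c = d"
    using abcd by (metis add.commute div_mult_self3 less_nat_zero_code div_less mod_mult_self3 mod_less add.right_neutral add_0 not_less_zero gr_implies_not0)
  thus "kron (1\<^sub>m m) (1\<^sub>m n) $$ (a * n + c, b * n + d) = (1\<^sub>m (m * n) :: 'a mat) $$ (a * n + c, b * n + d)"
    using abcd block_index_less[of a m c n] block_index_less[of b m d n]
    by (simp add: kron_index[of _ m m _ n n])
qed auto

lemma kron_one_mult_vec: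
  fixes A :: "'a :: semiring_1 mat"
  assumes A: "A \<in> carrier_mat m k" and w: "w \<in> carrier_vec (k * n)" and aq: "a < m" "q < n"
  shows "(kron A (1\<^sub>m n) *\<^sub>v w) $ (a * n + q) = (\<Sum>b<k. A $$ (a, b) * w $ (b * n + q))"
proof -
  have "(kron A (1\<^sub>m n) *\<^sub>v w) $ (a * n + q) = (\<Sum>c<k * n. kron A (1\<^sub>m n) $$ (a * n + q, c) * w $ c)"
    by (rule mult_mat_vec_index[OF kron_carrier[OF A one_carrier_mat] w block_index_less[OF aq]])
  also have "\<dots> = (\<Sum>b<k. \<Sum>d<n. if d = q then A $$ (a, b) * w $ (b * n + d) else 0)"
    unfolding sum_blocks
    by (intro sum.cong refl) (use aq in \<open>auto simp: kron_index[OF A one_carrier_mat]\<close>)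
  finally show ?thesis using aq by simp
qed

lemma one_kron_mult_vec:
  fixes B :: "'a :: semiring_1 mat"
  assumes B: "B \<in> carrier_mat p q" and w: "w \<in> carrier_vec (m * q)" and ia: "i < m" "a < p"
  shows "(kron (1\<^sub>m m) B *\<^sub>v w) $ (i * p + a) = (B *\<^sub>v vec q (\<lambda>b. w $ (i * q + b))) $ a"
proof -
  have "(kron (1\<^sub>m m) B *\<^sub>v w) $ (i * p + a) = (\<Sum>c<m * q. kron (1\<^sub>m m) B $$ (i * p + a, c) * w $ c)"
    by (rule mult_mat_vec_index[OF kron_carrier[OF one_carrier_mat B] w block_index_less[OF ia]])
  also have "\<dots> = (\<Sum>b<m. if b = i then \<Sum>d<q. B $$ (a, d) * w $ (b * q + d) else 0)"
    unfolding sum_blocks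
    by (intro sum.cong refl) (use ia in \<open>auto simp: kron_index[OF one_carrier_mat B]\<close>)
  also have "\<dots> = (\<Sum>d<q. B $$ (a, d) * w $ (i * q + d))" using ia by simp
  also have "\<dots> = (B *\<^sub>v vec q (\<lambda>b. w $ (i * q + b))) $ a"
    using ia B by (subst mult_mat_vec_index[OF B]) auto
  finally show ?thesis .
qed

section \<open>The structured factors\<close>

lemma W_mat_carrier [simp]: "W_mat t m a \<in> carrier_mat (t * m) (t * m)"
  by (simp add: W_mat_def mat_diag_dim)

lemma W_mat_mult_vec:
  assumes "w \<in> carrier_vec (t * m)" "i < t" "q < m"
  shows "(W_mat t m a *\<^sub>v w) $ (i * m + q) = complex_of_real (a $ i) * w $ (i * m + q)"
proof -
  have "(W_mat t m a *\<^sub>v w) $ (i * m + q) =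
      (\<Sum>b<t. mat_diag t (\<lambda>i. complex_of_real (a $ i)) $$ (i, b) * w $ (b * m + q))"
    unfolding W_mat_def by (rule kron_one_mult_vec[OF mat_diag_dim assms])
  also have "\<dots> = (\<Sum>b<t. if b = i then complex_of_real (a $ i) * w $ (b * m + q) else 0)"
    by (intro sum.cong refl) (use assms in \<open>auto simp: mat_diag_def\<close>)
  finally show ?thesis using assms by simp
qed

lemma W_mat_det_nonzero:
  assumes "a \<in> pos_vecs t"
  shows "det (W_mat t m a) \<noteq> 0"
proof
  assume "det (W_mat t m a) = 0"
  then obtain w where w: "w \<in> carrier_vec (t * m)" "w \<noteq> 0\<^sub>v (t * m)" "W_mat t m a *\<^sub>v w = 0\<^sub>v (t * m)"
    using det_0_iff_vec_prod_zero[OF W_mat_carrier] by blast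
  have "w = 0\<^sub>v (t * m)"
  proof (rule block_vec_eqI[of _ t m])
    fix i q assume iq: "i < t" "q < m"
    have "complex_of_real (a $ i) * w $ (i * m + q) = 0"
      using W_mat_mult_vec[OF w(1) iq, of a] w(3) block_index_less[OF iq] by simp
    thus "w $ (i * m + q) = 0\<^sub>v (t * m) $ (i * m + q)"
      using assms iq block_index_less[OF iq] by (auto simp: pos_vecs_def)
  qed (use w in auto)
  thus False using w(2) by simp
qed

lemma H_mat_carrier [simp]: "H_mat k r z \<in> carrier_mat (k + 1) (min r k + 1)"
  by (simp add: H_mat_def)

lemma M_mat_carrier [simp]: "M_mat n k r z \<in> carrier_mat ((k + 1) * n) ((min r k + 1) * n)"
  unfolding M_mat_def by (rule kron_carrier[OF H_mat_carrier one_carrier_mat])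

lemma E_mat_carrier [simp]: "E_mat n k r \<in> carrier_mat ((r + 1) * ((min r k + 1) * n)) ((r + 1) * n)"
proof -
  have "E_mat n k r \<in> carrier_mat ((r + 1) * (min r k + 1) * n) ((r + 1) * n)"
    unfolding E_mat_def by (rule kron_carrier[OF _ one_carrier_mat]) simp
  thus ?thesis by (simp only: mult.assoc)
qed

lemma H_mat_index:
  "l < k + 1 \<Longrightarrow> t < min r k + 1 \<Longrightarrow> H_mat k r z $$ (l, t) = coeff (taylor_shift z (monom 1 l)) t"
  by (simp add: H_mat_def coeff_taylor_shift)

lemma E_mat_mult_vec:
  assumes w: "w \<in> carrier_vec ((r + 1) * n)" and itq: "i < r + 1" "t < min r k + 1" "q < n"
  shows "(E_mat n k r *\<^sub>v w) $ (i * ((min r k + 1) * n) + (t * n + q)) =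
    (if t \<le> i then w $ ((i - t) * n + q) else 0)"
proof -
  let ?s = "min r k + 1"
  let ?F = "mat ((r + 1) * ?s) (r + 1) (\<lambda>(p, b). E_block r (p div ?s) $$ (p mod ?s, b)) :: complex mat"
  have F: "?F \<in> carrier_mat ((r + 1) * ?s) (r + 1)" by simp
  have its: "i * ?s + t < (r + 1) * ?s" by (rule block_index_less[OF itq(1,2)])
  have "(E_mat n k r *\<^sub>v w) $ (i * (?s * n) + (t * n + q)) = (kron ?F (1\<^sub>m n) *\<^sub>v w) $ ((i * ?s + t) * n + q)"
    unfolding E_mat_def by (simp only: distrib_right mult.assoc add.assoc)
  also have "\<dots> = (\<Sum>b<r + 1. ?F $$ (i * ?s + t, b) * w $ (b * n + q))"
    by (rule kron_one_mult_vec[OF F w its itq(3)])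
  also have "\<dots> = (\<Sum>b<r + 1. if b = i - t then (if t \<le> i then w $ (b * n + q) else 0) else 0)"
  proof (intro sum.cong refl)
    fix b assume b: "b \<in> {..<r + 1}"
    have d: "(i * ?s + t) div ?s = i" "(i * ?s + t) mod ?s = t"
      using itq by (simp_all only: div_mult_self3 mod_mult_self3 div_less mod_less)
    have "?F $$ (i * ?s + t, b) = E_block r ((i * ?s + t) div ?s) $$ ((i * ?s + t) mod ?s, b)"
      using its b by simp
    also have "\<dots> = (if t + b = i then 1 else 0)"
      unfolding d using itq b by (simp add: E_block_def)
    finally show "?F $$ (i * ?s + t, b) * w $ (b * n + q) =
        (if b = i - t then (if t \<le> i then w $ (b * n + q) else 0) else 0)"
      by (simp only:) auto
  qed
  also have "\<dots> = (if t \<le> i then w $ ((i - t) * n + q) else 0)"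
    using less_imp_diff_less[OF itq(1), of t]
    by (simp only: sum.delta finite_lessThan lessThan_iff if_True)
  finally show ?thesis .
qed

text \<open>The factors \<open>M\<close> and \<open>E\<close> together expand the products \<open>\<lambda>\<^sup>l y(\<lambda>)\<close> at \<open>z\<close>: \<open>E\<close> aligns the
  coefficients of \<open>y\<close> for a convolution and \<open>H\<close> contains the Taylor coefficients of \<open>\<lambda>\<^sup>l\<close>.\<close>

lemma M_E_mult_vec:
  assumes w: "w \<in> carrier_vec ((r + 1) * n)" "\<And>j q. j < r + 1 \<Longrightarrow> q < n \<Longrightarrow> w $ (j * n + q) = coeff (y q) j"
    and ilq: "i < r + 1" "l < k + 1" "q < n"
  shows "(kron (1\<^sub>m (r + 1)) (M_mat n k r z) *\<^sub>v (E_mat n k r *\<^sub>v w)) $ (i * ((k + 1) * n) + (l * n + q)) =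
    coeff (taylor_shift z (monom 1 l) * y q) i"
proof -
  let ?s = "min r k + 1"
  let ?e = "E_mat n k r *\<^sub>v w"
  have e: "?e \<in> carrier_vec ((r + 1) * (?s * n))" by (rule mult_mat_vec_carrier[OF E_mat_carrier w(1)])
  have "(kron (1\<^sub>m (r + 1)) (M_mat n k r z) *\<^sub>v ?e) $ (i * ((k + 1) * n) + (l * n + q)) =
      (M_mat n k r z *\<^sub>v vec (?s * n) (\<lambda>b. ?e $ (i * (?s * n) + b))) $ (l * n + q)"
    by (rule one_kron_mult_vec[OF M_mat_carrier e ilq(1) block_index_less[OF ilq(2,3)]])
  also have "\<dots> = (\<Sum>t<?s. H_mat k r z $$ (l, t) * vec (?s * n) (\<lambda>b. ?e $ (i * (?s * n) + b)) $ (t * n + q))"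
    unfolding M_mat_def by (rule kron_one_mult_vec[OF H_mat_carrier _ ilq(2,3)]) (rule vec_carrier)
  also have "\<dots> = (\<Sum>t<?s. if t \<le> i then coeff (taylor_shift z (monom 1 l)) t * coeff (y q) (i - t) else 0)"
  proof (intro sum.cong refl)
    fix t assume "t \<in> {..<?s}"
    hence t: "t < ?s" by simp
    have "vec (?s * n) (\<lambda>b. ?e $ (i * (?s * n) + b)) $ (t * n + q) = ?e $ (i * (?s * n) + (t * n + q))"
      by (rule index_vec[OF block_index_less[OF t ilq(3)]])
    also have "\<dots> = (if t \<le> i then coeff (y q) (i - t) else 0)"
      using E_mat_mult_vec[OF w(1) ilq(1) t ilq(3)] w(2)[of "i - t" q] ilq by simp
    finally show "H_mat k r z $$ (l, t) * vec (?s * n) (\<lambda>b. ?e $ (i * (?s * n) + b)) $ (t * n + q) =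
       (if t \<le> i then coeff (taylor_shift z (monom 1 l)) t * coeff (y q) (i - t) else 0)"
      by (simp only: H_mat_index[OF ilq(2) t]) simp
  qed
  also have "\<dots> = (\<Sum>t\<le>i. coeff (taylor_shift z (monom 1 l)) t * coeff (y q) (i - t))"
  \<comment> \<open>A Taylor coefficient that was cut off has index greater than \<open>k\<close>, hence above the degree of \<open>\<lambda>\<^sup>l\<close>.\<close>
  proof (rule sum.mono_neutral_cong)
    fix t assume "t \<in> {..i} - {..<?s}"
    hence "degree (taylor_shift z (monom 1 l)) < t"
      using ilq degree_monom_le[of "1 :: complex" l] by (auto simp: degree_pcompose)
    thus "coeff (taylor_shift z (monom 1 l)) t * coeff (y q) (i - t) = 0"
      by (simp add: coeff_eq_0)
  qed auto
  also have "\<dots> = coeff (taylor_shift z (monom 1 l) * y q) i" by (rule coeff_mult[symmetric])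
  finally show ?thesis .
qed

section \<open>The perturbation acts through its coefficients\<close>

lemma mat_poly_carrier [simp]: "mat_poly n k A \<in> carrier_mat n n"
  by (simp add: mat_poly_def)

lemma shifted_row_sum_add:
  assumes "P \<in> carrier_mat n n" "D \<in> carrier_mat n n" "p < n"
  shows "shifted_row_sum n z (P + D) y p = shifted_row_sum n z P y p + shifted_row_sum n z D y p"
  using assms by (simp add: shifted_row_sum_def pcompose_add distrib_right sum.distrib)

lemma taylor_shift_mat_poly:
  assumes "p < n" "q < n"
  shows "taylor_shift z (mat_poly n k A $$ (p, q)) =
    (\<Sum>l<k + 1. smult (A l $$ (p, q)) (taylor_shift z (monom 1 l)))"
proof -
  have "mat_poly n k A $$ (p, q) = (\<Sum>l<k + 1. smult (A l $$ (p, q)) (monom 1 l))"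
    using assms by (simp add: mat_poly_def smult_monom lessThan_Suc_atMost)
  thus ?thesis by (simp only: pcompose_sum pcompose_smult)
qed

lemma coeff_row_carrier [simp]: "coeff_row n k A \<in> carrier_mat n ((k + 1) * n)"
  by (simp add: coeff_row_def)

text \<open>A perturbation \<open>\<Sum>\<^sub>l \<lambda>\<^sup>l A\<^sub>l\<close> applied to \<open>y\<close> is \<open>\<Sum>\<^sub>l A\<^sub>l (\<lambda>\<^sup>l y)\<close>, so every Taylor coefficient is the row
  of the \<open>A\<^sub>l\<close> times a vector that depends only on \<open>y\<close>. The factor \<open>c\<close> leaves room for the weights.\<close>

lemma coeff_row_mult_vec:
  assumes p: "p < n"
    and u: "u \<in> carrier_vec ((k + 1) * n)"
      "\<And>l q. l < k + 1 \<Longrightarrow> q < n \<Longrightarrow> u $ (l * n + q) = c * coeff (taylor_shift z (monom 1 l) * y q) i"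
  shows "(coeff_row n k A *\<^sub>v u) $ p = c * coeff (shifted_row_sum n z (mat_poly n k A) y p) i"
proof -
  have "(coeff_row n k A *\<^sub>v u) $ p = (\<Sum>b<(k + 1) * n. coeff_row n k A $$ (p, b) * u $ b)"
    by (rule mult_mat_vec_index[OF coeff_row_carrier u(1) p])
  also have "\<dots> = (\<Sum>l<k + 1. \<Sum>q<n. c * (A l $$ (p, q) * coeff (taylor_shift z (monom 1 l) * y q) i))"
    unfolding sum_blocks
  proof (intro sum.cong refl)
    fix l q assume "l \<in> {..<k + 1}" "q \<in> {..<n}"
    hence lq: "l < k + 1" "q < n" by simp_all
    have "coeff_row n k A $$ (p, l * n + q) = A l $$ (p, q)"
      using p lq block_index_less[OF lq] by (simp add: coeff_row_def)
    thus "coeff_row n k A $$ (p, l * n + q) * u $ (l * n + q) =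
        c * (A l $$ (p, q) * coeff (taylor_shift z (monom 1 l) * y q) i)"
      by (simp only: u(2)[OF lq]) (simp add: mult_ac)
  qed
  also have "\<dots> = (\<Sum>q<n. \<Sum>l<k + 1. c * (A l $$ (p, q) * coeff (taylor_shift z (monom 1 l) * y q) i))"
    by (rule sum.swap)
  also have "\<dots> = c * (\<Sum>q<n. coeff (taylor_shift z (mat_poly n k A $$ (p, q)) * y q) i)"
    unfolding sum_distrib_left
  proof (intro sum.cong refl)
    fix q assume "q \<in> {..<n}"
    hence q: "q < n" by simp
    show "(\<Sum>l<k + 1. c * (A l $$ (p, q) * coeff (taylor_shift z (monom 1 l) * y q) i)) =
        c * coeff (taylor_shift z (mat_poly n k A $$ (p, q)) * y q) i"
      by (simp only: taylor_shift_mat_poly[OF p q] sum_distrib_right coeff_sum mult_smult_left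
          coeff_smult sum_distrib_left)
  qed
  also have "\<dots> = c * coeff (shifted_row_sum n z (mat_poly n k A) y p) i"
    by (simp only: shifted_row_sum_def coeff_sum)
  finally show ?thesis .
qed

section \<open>The test space spanned by a Jordan chain\<close>

text \<open>Column \<open>j\<close> contains the Taylor coefficients at \<open>z\<close> of \<open>(\<lambda> - z)\<^sup>j x(\<lambda>)\<close> up to degree \<open>r\<close>: the
  Jordan chain of \<open>x\<close>, shifted down by \<open>j\<close> blocks.\<close>

definition jordan_chain_mat :: "nat \<Rightarrow> nat \<Rightarrow> complex \<Rightarrow> complex poly vec \<Rightarrow> complex mat" where
  "jordan_chain_mat n r z x = mat ((r + 1) * n) (r + 1)
     (\<lambda>(b, j). if j \<le> b div n then coeff (taylor_shift z (x $ (b mod n))) (b div n - j) else 0)"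

lemma jordan_chain_mat_carrier [simp]: "jordan_chain_mat n r z x \<in> carrier_mat ((r + 1) * n) (r + 1)"
  by (simp add: jordan_chain_mat_def)

definition vec_poly :: "complex vec \<Rightarrow> complex poly" where
  "vec_poly c = (\<Sum>j<dim_vec c. monom (c $ j) j)"

lemma coeff_vec_poly: "coeff (vec_poly c) j = (if j < dim_vec c then c $ j else 0)"
  by (simp add: vec_poly_def coeff_sum)

lemma jordan_chain_mat_mult_vec:
  assumes c: "c \<in> carrier_vec (r + 1)" and iq: "i < r + 1" "q < n"
  shows "(jordan_chain_mat n r z x *\<^sub>v c) $ (i * n + q) = coeff (taylor_shift z (x $ q) * vec_poly c) i"
proof -
  have "(jordan_chain_mat n r z x *\<^sub>v c) $ (i * n + q) =
      (\<Sum>j<r + 1. jordan_chain_mat n r z x $$ (i * n + q, j) * c $ j)"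
    by (rule mult_mat_vec_index[OF jordan_chain_mat_carrier c block_index_less[OF iq]])
  also have "\<dots> = (\<Sum>j\<le>i. coeff (vec_poly c) j * coeff (taylor_shift z (x $ q)) (i - j))"
    using iq block_index_less[OF iq] c
    by (intro sum.mono_neutral_cong_right) (auto simp: jordan_chain_mat_def coeff_vec_poly)
  also have "\<dots> = coeff (vec_poly c * taylor_shift z (x $ q)) i" by (rule coeff_mult[symmetric])
  finally show ?thesis by (simp only: mult.commute)
qed

lemma jordan_chain_mat_inj:
  assumes c: "c \<in> carrier_vec (r + 1)" and x: "\<exists>q<n. poly (x $ q) z \<noteq> 0"
    and zero: "jordan_chain_mat n r z x *\<^sub>v c = 0\<^sub>v ((r + 1) * n)"
  shows "c = 0\<^sub>v (r + 1)"
proof (rule eq_vecI)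
  obtain q where q: "q < n" "poly (x $ q) z \<noteq> 0" using x by blast
  fix j assume j: "j < dim_vec (0\<^sub>v (r + 1))"
  have "coeff (vec_poly c) j = 0"
  proof (rule coeff_mult_low_zero_cancel[of "taylor_shift z (x $ q)" r])
    show "\<forall>i\<le>r. coeff (taylor_shift z (x $ q) * vec_poly c) i = 0"
    proof (intro allI impI)
      fix i assume "i \<le> r"
      hence i: "i < r + 1" by simp
      show "coeff (taylor_shift z (x $ q) * vec_poly c) i = 0"
        using jordan_chain_mat_mult_vec[OF c i q(1), of z x] zero block_index_less[OF i q(1)] by simp
    qed
  qed (use q j in \<open>auto simp: coeff_0_taylor_shift\<close>)
  thus "c $ j = 0\<^sub>v (r + 1) $ j" using j c by (simp add: coeff_vec_poly)
qed (use c in auto)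

section \<open>The lower bound\<close>

text \<open>Let \<open>Q = P + \<Delta>P\<close> and let \<open>X\<close> contain the shifted Jordan chains of \<open>Q\<close> at \<open>z\<close>, so that
  \<open>T(Q) X = 0\<close>, that is \<open>T(P) X = - T(\<Delta>P) X\<close>. Take \<open>V = W T(P) X\<close>. The factor \<open>B\<close> was built so
  that \<open>W T(\<Delta>P) = (I \<otimes> [\<Delta>A\<^sub>0 \<dots> \<Delta>A\<^sub>k]) B W T(P)\<close>: the weights commute with \<open>I \<otimes> [\<Delta>A\<^sub>0 \<dots> \<Delta>A\<^sub>k]\<close>
  because they are constant on blocks. Hence \<open>V c = - (I \<otimes> [\<Delta>A\<^sub>0 \<dots> \<Delta>A\<^sub>k]) B V c\<close> on a space of
  dimension \<open>r + 1\<close>, which bounds the singular value from below.\<close>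

lemma B_mat_lower_bound:
  assumes P: "P \<in> carrier_mat n n" and n: "0 < n" and z: "poly (det P) z \<noteq> 0"
    and a: "a \<in> pos_vecs (r + 1)"
    and \<Delta>: "elementary_divisor n (P + mat_poly n k \<Delta>) ([:- z, 1:] ^ j)" "r + 1 \<le> j"
  shows "1 \<le> spectral_norm (coeff_row n k \<Delta>) * sing_val (r + 1) (B_mat n k r z a P)"
proof -
  let ?N = "(r + 1) * n" and ?L = "(k + 1) * n" and ?S = "(min r k + 1) * n"
  define T where "T = toeplitz n r P z"
  define W where "W = W_mat (r + 1) n a"
  define W1 where "W1 = W_mat (r + 1) ?L a"
  define K where "K = kron (1\<^sub>m (r + 1)) (M_mat n k r z)"
  define E where "E = E_mat n k r"
  have T: "T \<in> carrier_mat ?N ?N" unfolding T_def by (rule toeplitz_carrier)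
  have W: "W \<in> carrier_mat ?N ?N" unfolding W_def by (rule W_mat_carrier)
  have W1: "W1 \<in> carrier_mat ((r + 1) * ?L) ((r + 1) * ?L)" unfolding W1_def by (rule W_mat_carrier)
  have K: "K \<in> carrier_mat ((r + 1) * ?L) ((r + 1) * ?S)"
    unfolding K_def by (rule kron_carrier[OF one_carrier_mat M_mat_carrier])
  have E: "E \<in> carrier_mat ((r + 1) * ?S) ?N" unfolding E_def by (rule E_mat_carrier)
  note Ti = mat_inv[OF T toeplitz_det_nonzero[OF P z, of r, folded T_def]]
  note Wi = mat_inv[OF W W_mat_det_nonzero[OF a, of n, folded W_def]]
  define B where "B = B_mat n k r z a P"
  have B_eq: "B = W1 * K * E * mat_inv T * mat_inv W"
    by (simp only: B_def B_mat_def W1_def K_def E_def T_def W_def)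
  note W1K = mult_carrier_mat[OF W1 K]
  note W1KE = mult_carrier_mat[OF W1K E]
  note W1KET = mult_carrier_mat[OF W1KE Ti(1)]
  have B: "B \<in> carrier_mat ((r + 1) * ?L) ?N"
    unfolding B_eq by (rule mult_carrier_mat[OF W1KET Wi(1)])
  have cancel: "B *\<^sub>v (W *\<^sub>v (T *\<^sub>v w)) = W1 *\<^sub>v (K *\<^sub>v (E *\<^sub>v w))" if w: "w \<in> carrier_vec ?N" for w
  proof -
    have Tw: "T *\<^sub>v w \<in> carrier_vec ?N" by (rule mult_mat_vec_carrier[OF T w])
    have WTw: "W *\<^sub>v (T *\<^sub>v w) \<in> carrier_vec ?N" by (rule mult_mat_vec_carrier[OF W Tw])
    have "mat_inv W *\<^sub>v (W *\<^sub>v (T *\<^sub>v w)) = T *\<^sub>v w"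
      by (simp only: assoc_mult_mat_vec[OF Wi(1) W Tw, symmetric] Wi(3) one_mult_mat_vec[OF Tw])
    moreover have "mat_inv T *\<^sub>v (T *\<^sub>v w) = w"
      by (simp only: assoc_mult_mat_vec[OF Ti(1) T w, symmetric] Ti(3) one_mult_mat_vec[OF w])
    ultimately show ?thesis
      by (simp only: B_eq assoc_mult_mat_vec[OF W1KET Wi(1) WTw] assoc_mult_mat_vec[OF W1KE Ti(1) Tw]
          assoc_mult_mat_vec[OF W1K E w] assoc_mult_mat_vec[OF W1 K mult_mat_vec_carrier[OF E w]])
  qed
  obtain x where x: "x \<in> carrier_vec n" "\<exists>q<n. poly (x $ q) z \<noteq> 0"
    and dvd: "\<And>p. p < n \<Longrightarrow> [:- z, 1:] ^ j dvd ((P + mat_poly n k \<Delta>) *\<^sub>v x) $ p"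
    using elementary_divisor_local_kernel[OF \<Delta>(1)] \<Delta>(2) by (metis add_leD2)
  define X where "X = jordan_chain_mat n r z x"
  have X: "X \<in> carrier_mat ?N (r + 1)" unfolding X_def by (rule jordan_chain_mat_carrier)
  define V where "V = W * T * X"
  have V: "V \<in> carrier_mat ?N (r + 1)"
    unfolding V_def by (rule mult_carrier_mat[OF mult_carrier_mat[OF W T] X])
  have V_mult: "V *\<^sub>v c = W *\<^sub>v (T *\<^sub>v (X *\<^sub>v c))" if c: "c \<in> carrier_vec (r + 1)" for c
    by (simp only: V_def assoc_mult_mat_vec[OF mult_carrier_mat[OF W T] X c]
        assoc_mult_mat_vec[OF W T mult_mat_vec_carrier[OF X c]])
  have inj: "c = 0\<^sub>v (r + 1)" if c: "c \<in> carrier_vec (r + 1)" and V0: "V *\<^sub>v c = 0\<^sub>v ?N" for c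
  proof -
    have Xc: "X *\<^sub>v c \<in> carrier_vec ?N" by (rule mult_mat_vec_carrier[OF X c])
    have TXc: "T *\<^sub>v (X *\<^sub>v c) \<in> carrier_vec ?N" by (rule mult_mat_vec_carrier[OF T Xc])
    have "W *\<^sub>v (T *\<^sub>v (X *\<^sub>v c)) = 0\<^sub>v ?N" using V0 V_mult[OF c] by simp
    hence "T *\<^sub>v (X *\<^sub>v c) = 0\<^sub>v ?N"
      using det_0_iff_vec_prod_zero[OF W] W_mat_det_nonzero[OF a, of n, folded W_def] TXc by blast
    hence "X *\<^sub>v c = 0\<^sub>v ?N"
      using det_0_iff_vec_prod_zero[OF T] toeplitz_det_nonzero[OF P z, of r, folded T_def] Xc by blast
    thus ?thesis using jordan_chain_mat_inj[OF c x(2)] by (simp add: X_def)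
  qed
  have bound: "vec_norm2 (V *\<^sub>v c) \<le> spectral_norm (coeff_row n k \<Delta>) * vec_norm2 (B *\<^sub>v (V *\<^sub>v c))"
    if c: "c \<in> carrier_vec (r + 1)" for c
  proof -
    define w where "w = X *\<^sub>v c"
    define y where "y q = taylor_shift z (x $ q) * vec_poly c" for q
    have w: "w \<in> carrier_vec ?N" unfolding w_def by (rule mult_mat_vec_carrier[OF X c])
    have wy: "w $ (i * n + q) = coeff (y q) i" if "i < r + 1" "q < n" for i q
      unfolding w_def X_def y_def by (rule jordan_chain_mat_mult_vec[OF c that])
    have Tw: "T *\<^sub>v w \<in> carrier_vec ?N" by (rule mult_mat_vec_carrier[OF T w])
    have Ew: "E *\<^sub>v w \<in> carrier_vec ((r + 1) * ?S)" by (rule mult_mat_vec_carrier[OF E w])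
    have KEw: "K *\<^sub>v (E *\<^sub>v w) \<in> carrier_vec ((r + 1) * ?L)" by (rule mult_mat_vec_carrier[OF K Ew])
    define u where "u = W1 *\<^sub>v (K *\<^sub>v (E *\<^sub>v w))"
    define v where "v = W *\<^sub>v (T *\<^sub>v w)"
    have u: "u \<in> carrier_vec ((r + 1) * ?L)" unfolding u_def by (rule mult_mat_vec_carrier[OF W1 KEw])
    have v: "v \<in> carrier_vec ?N" unfolding v_def by (rule mult_mat_vec_carrier[OF W Tw])
    have row_zero: "coeff (shifted_row_sum n z (P + mat_poly n k \<Delta>) y p) i = 0"
      if "i < r + 1" "p < n" for i p
    proof -
      have "shifted_row_sum n z (P + mat_poly n k \<Delta>) y p =
          taylor_shift z (((P + mat_poly n k \<Delta>) *\<^sub>v x) $ p) * vec_poly c"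
        using x(1) that P
        by (subst mult_mat_vec_index[OF add_carrier_mat[OF mat_poly_carrier] x(1) that(2)])
          (simp add: shifted_row_sum_def y_def pcompose_sum pcompose_mult sum_distrib_left
             mult_ac sum_distrib_right)
      also have "coeff \<dots> i = 0"
        unfolding mult.commute[of _ "vec_poly c"]
        by (rule coeff_mult_low_zero[of i])
          (use coeff_taylor_shift_dvd[OF dvd[OF that(2)]] that \<Delta>(2) in auto)
      finally show ?thesis .
    qed
    have "vec_norm2 v \<le> spectral_norm (coeff_row n k \<Delta>) * vec_norm2 u"
    proof (rule vec_norm2_le_blockwise[OF coeff_row_carrier v u])
      fix i assume i: "i < r + 1"
      let ?u = "vec ?L (\<lambda>b. u $ (i * ?L + b))"
      show "vec n (\<lambda>p. v $ (i * n + p)) = - (coeff_row n k \<Delta> *\<^sub>v ?u)"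
      proof (rule eq_vecI)
        fix p assume "p < dim_vec (- (coeff_row n k \<Delta> *\<^sub>v ?u))"
        hence p: "p < n" by (simp add: coeff_row_def)
        have "v $ (i * n + p) = complex_of_real (a $ i) * coeff (shifted_row_sum n z P y p) i"
          unfolding v_def W_def W_mat_mult_vec[OF Tw i p] unfolding T_def
          by (simp only: toeplitz_mult_vec[OF P w wy i p])
        also have "coeff (shifted_row_sum n z P y p) i = - coeff (shifted_row_sum n z (mat_poly n k \<Delta>) y p) i"
          using row_zero[OF i p] unfolding shifted_row_sum_add[OF P mat_poly_carrier p]
          by (simp add: eq_neg_iff_add_eq_0)
        finally have v_ip: "v $ (i * n + p) =
            - (complex_of_real (a $ i) * coeff (shifted_row_sum n z (mat_poly n k \<Delta>) y p) i)"
          by simp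
        have "(coeff_row n k \<Delta> *\<^sub>v ?u) $ p =
            complex_of_real (a $ i) * coeff (shifted_row_sum n z (mat_poly n k \<Delta>) y p) i"
        proof (rule coeff_row_mult_vec[OF p])
          fix l q assume lq: "l < k + 1" "q < n"
          have "?u $ (l * n + q) = u $ (i * ?L + (l * n + q))"
            by (rule index_vec[OF block_index_less[OF lq]])
          also have "\<dots> = complex_of_real (a $ i) * coeff (taylor_shift z (monom 1 l) * y q) i"
            unfolding u_def W1_def W_mat_mult_vec[OF KEw i block_index_less[OF lq]]
            unfolding K_def E_def by (simp only: M_E_mult_vec[OF w wy i lq])
          finally show "?u $ (l * n + q) = complex_of_real (a $ i) * coeff (taylor_shift z (monom 1 l) * y q) i" .
        qed (rule vec_carrier)
        thus "vec n (\<lambda>p. v $ (i * n + p)) $ p = (- (coeff_row n k \<Delta> *\<^sub>v ?u)) $ p"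
          using p v_ip by (simp add: coeff_row_def del: index_mult_mat_vec)
      qed (simp add: coeff_row_def)
    qed
    thus ?thesis by (simp only: V_mult[OF c] w_def[symmetric] cancel[OF w] u_def v_def)
  qed
  have "r < ?N" using n by (cases n) auto
  from sing_val_lower_bound[OF B V this inj spectral_norm_nonneg bound]
  show ?thesis by (simp only: B_def)
qed

text \<open>The estimate \<open>1 \<le> \<nu> * \<sigma>\<close> also shows that the singular value is positive as soon as some
  admissible perturbation exists; otherwise the distance is \<open>\<infinity>\<close>.\<close>

lemma ed_dist_lower_bound:
  assumes P: "P \<in> carrier_mat n n" and n: "0 < n" and z: "poly (det P) z \<noteq> 0"
  shows "(SUP a \<in> pos_vecs (r + 1). inverse (ereal (sing_val (r + 1) (B_mat n k r z a P)))) \<le> ed_dist s n k P z (r + 1)"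
proof (rule SUP_least)
  fix a assume a: "a \<in> pos_vecs (r + 1)"
  define \<sigma> where "\<sigma> = sing_val (r + 1) (B_mat n k r z a P)"
  show "inverse (ereal \<sigma>) \<le> ed_dist s n k P z (r + 1)"
    unfolding ed_dist_def
  proof (rule INF_greatest)
    fix \<Delta> assume "\<Delta> \<in> {\<Delta>. (\<forall>i\<le>k. \<Delta> i \<in> carrier_mat n n) \<and>
        (\<exists>j\<ge>r + 1. elementary_divisor n (P + mat_poly n k \<Delta>) ([:- z, 1:] ^ j))}"
    then obtain j where \<Delta>: "\<forall>i\<le>k. \<Delta> i \<in> carrier_mat n n"
      and j: "r + 1 \<le> j" "elementary_divisor n (P + mat_poly n k \<Delta>) ([:- z, 1:] ^ j)" by blast
    define \<nu> where "\<nu> = spectral_norm (coeff_row n k \<Delta>)"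
    have "1 \<le> \<nu> * \<sigma>"
      unfolding \<nu>_def \<sigma>_def by (rule B_mat_lower_bound[OF P n z a j(2,1)])
    moreover have "0 \<le> \<nu>" unfolding \<nu>_def by (rule spectral_norm_nonneg)
    ultimately have "0 < \<sigma>" using mult_nonneg_nonpos[of \<nu> \<sigma>] by linarith
    have "inverse (ereal \<sigma>) = ereal (1 / \<sigma>)" using \<open>0 < \<sigma>\<close> by (simp add: inverse_eq_divide)
    also have "\<dots> \<le> ereal \<nu>" using \<open>0 < \<sigma>\<close> \<open>1 \<le> \<nu> * \<sigma>\<close> by (simp add: divide_le_eq)
    also have "\<dots> \<le> ereal (tri_norm s n k \<Delta>)"
      unfolding \<nu>_def using spectral_norm_le_tri_norm[OF \<Delta>] by simp
    finally show "inverse (ereal \<sigma>) \<le> ereal (tri_norm s n k \<Delta>)" .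
  qed
qed

section \<open>The point zero\<close>

text \<open>At \<open>0\<close> the Taylor coefficients of \<open>\<lambda>\<^sup>l\<close> are Kronecker symbols, so \<open>M\<close> pads a vector with zeros.\<close>

lemma M_mat_0_isometry: "mat_adjoint (M_mat n k r 0) * M_mat n k r 0 = 1\<^sub>m ((min r k + 1) * n)"
proof -
  have H: "H_mat k r 0 $$ (l, t) = (if l = t then 1 else 0)" if "l < k + 1" "t < min r k + 1" for l t
    by (simp add: H_mat_index[OF that] coeff_monom)
  note Hc = H_mat_carrier[of k r 0]
  have "mat_adjoint (H_mat k r 0) * H_mat k r 0 = 1\<^sub>m (min r k + 1)"
  proof (rule eq_matI)
    fix i j assume "i < dim_row (1\<^sub>m (min r k + 1))" "j < dim_col (1\<^sub>m (min r k + 1))"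
    hence ij: "i < min r k + 1" "j < min r k + 1" by simp_all
    have "(mat_adjoint (H_mat k r 0) * H_mat k r 0) $$ (i, j) =
        (\<Sum>l<k + 1. mat_adjoint (H_mat k r 0) $$ (i, l) * H_mat k r 0 $$ (l, j))"
      by (rule mult_mat_index[OF mat_adjoint_carrier[OF Hc] Hc ij])
    also have "\<dots> = (\<Sum>l<k + 1. if l = j then if i = j then 1 else 0 else 0)"
      by (intro sum.cong refl) (use ij Hc in \<open>auto simp: H\<close>)
    also have "\<dots> = (if i = j then 1 else 0)"
      using less_le_trans[OF ij(2), of "k + 1"]
      by (simp only: sum.delta finite_lessThan lessThan_iff) simp
    also have "\<dots> = 1\<^sub>m (min r k + 1) $$ (i, j)" using ij by simp
    finally show "(mat_adjoint (H_mat k r 0) * H_mat k r 0) $$ (i, j) = 1\<^sub>m (min r k + 1) $$ (i, j)" .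
  qed (use Hc in auto)
  moreover have "mat_adjoint (1\<^sub>m n) = (1\<^sub>m n :: complex mat)" by (intro eq_matI) auto
  ultimately show ?thesis
    unfolding M_mat_def kron_adjoint[OF Hc one_carrier_mat]
    by (simp only: kron_mult[OF mat_adjoint_carrier[OF Hc] Hc one_carrier_mat one_carrier_mat]
        left_mult_one_mat[OF one_carrier_mat] kron_one_one)
qed

text \<open>The block constant weights move through \<open>I \<otimes> M\<close>, so \<open>B = (I \<otimes> M) Bhat\<close> with an isometry
  \<open>I \<otimes> M\<close>, and both matrices have the same Gram matrix.\<close>

lemma sing_val_B_hat:
  assumes P: "P \<in> carrier_mat n n" and z: "poly (det P) 0 \<noteq> 0" and a: "a \<in> pos_vecs (r + 1)"
  shows "sing_val i (B_mat n k r 0 a P) = sing_val i (B_hat_mat n k r 0 a P)"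
proof -
  let ?N = "(r + 1) * n" and ?L = "(k + 1) * n" and ?S = "(min r k + 1) * n"
  define M where "M = M_mat n k r 0"
  define K where "K = kron (1\<^sub>m (r + 1)) M"
  define D where "D = mat_diag (r + 1) (\<lambda>i. complex_of_real (a $ i))"
  have M: "M \<in> carrier_mat ?L ?S" unfolding M_def by (rule M_mat_carrier)
  have K: "K \<in> carrier_mat ((r + 1) * ?L) ((r + 1) * ?S)"
    unfolding K_def by (rule kron_carrier[OF one_carrier_mat M])
  have D: "D \<in> carrier_mat (r + 1) (r + 1)" unfolding D_def by (rule mat_diag_dim)
  have W: "W_mat (r + 1) m a = kron D (1\<^sub>m m)" for m by (simp only: W_mat_def D_def)
  have "W_mat (r + 1) ?L a * K = kron D M"
    unfolding W K_def using D M by (simp only: kron_mult[OF D one_carrier_mat one_carrier_mat M]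
      right_mult_one_mat[OF D] left_mult_one_mat[OF M])
  also have "\<dots> = K * W_mat (r + 1) ?S a"
    unfolding W K_def using D M by (simp only: kron_mult[OF one_carrier_mat D M one_carrier_mat]
      left_mult_one_mat[OF D] right_mult_one_mat[OF M])
  finally have comm: "W_mat (r + 1) ?L a * K = K * W_mat (r + 1) ?S a" .
  have adj1: "mat_adjoint (1\<^sub>m (r + 1)) = (1\<^sub>m (r + 1) :: complex mat)" by (intro eq_matI) auto
  have isom: "mat_adjoint K * K = 1\<^sub>m ((r + 1) * ?S)"
    unfolding K_def kron_adjoint[OF one_carrier_mat M] adj1
    using M_mat_0_isometry[of n k r, folded M_def]
    by (simp only: kron_mult[OF one_carrier_mat one_carrier_mat mat_adjoint_carrier[OF M] M]
        left_mult_one_mat[OF one_carrier_mat] kron_one_one)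
  define C where "C = B_hat_mat n k r 0 a P"
  note Ti = mat_inv(1)[OF toeplitz_carrier toeplitz_det_nonzero[OF P z, of r]]
  note Wi = mat_inv(1)[OF W_mat_carrier W_mat_det_nonzero[OF a, of n]]
  note W2 = W_mat_carrier[of "r + 1" ?S a]
  note E = E_mat_carrier[of n k r]
  note W2E = mult_carrier_mat[OF W2 E]
  note W2ET = mult_carrier_mat[OF W2E Ti]
  have C: "C \<in> carrier_mat ((r + 1) * ?S) ?N"
    unfolding C_def B_hat_mat_def by (rule mult_carrier_mat[OF W2ET Wi])
  have "B_mat n k r 0 a P = K * W_mat (r + 1) ?S a * E_mat n k r * mat_inv (toeplitz n r P 0) * mat_inv (W_mat (r + 1) n a)"
    unfolding B_mat_def M_def[symmetric] K_def[symmetric] comm ..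
  also have "\<dots> = K * C"
    unfolding C_def B_hat_mat_def
    by (simp only: assoc_mult_mat[OF K W2 E] assoc_mult_mat[OF K W2E Ti] assoc_mult_mat[OF K W2ET Wi])
  finally have B: "B_mat n k r 0 a P = K * C" .
  have "mat_adjoint (K * C) * (K * C) = mat_adjoint C * ((mat_adjoint K * K) * C)"
    unfolding mat_adjoint_mult[OF K C]
    by (simp only: assoc_mult_mat[OF mat_adjoint_carrier[OF C] mat_adjoint_carrier[OF K] mult_carrier_mat[OF K C]]
        assoc_mult_mat[OF mat_adjoint_carrier[OF K] K C])
  also have "\<dots> = mat_adjoint C * C" unfolding isom by (simp only: left_mult_one_mat[OF C])
  finally show ?thesis by (simp only: B C_def[symmetric] sing_val_def sing_vals_def)
qed

section \<open>Lower bounds for the distance\<close>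

theorem theorem7p3:
  fixes n k r :: nat and A :: "nat \<Rightarrow> complex mat" and P :: "complex poly mat"
    and z0 :: complex and s :: norm_type
  assumes "\<forall>i\<le>k. A i \<in> carrier_mat n n"
    and "A k \<noteq> 0\<^sub>m n n"
    and "P = mat_poly n k A"
    and "regular_mat_poly P"
    and "1 \<le> r" and "r < k * n"
    and "\<not> mat_poly_eigenvalue P z0"
  shows "ed_dist s n k P z0 (r + 1)
           \<ge> (SUP a \<in> pos_vecs (r + 1). inverse (ereal (sing_val (r + 1) (B_mat n k r z0 a P))))
       \<and> (z0 = 0 \<longrightarrow>
           ed_dist s n k P 0 (r + 1)
             \<ge> (SUP a \<in> pos_vecs (r + 1). inverse (ereal (sing_val (r + 1) (B_hat_mat n k r 0 a P)))))"
proof -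
  have P: "P \<in> carrier_mat n n" using assms(3) by simp
  have n: "0 < n" using assms(6) by (cases n) auto
  have z: "poly (det P) z0 \<noteq> 0" using assms(7) by (simp add: mat_poly_eigenvalue_def)
  note bound = ed_dist_lower_bound[OF P n z, of r k s]
  show ?thesis
  proof (intro conjI impI)
    assume z0: "z0 = 0"
    have "(SUP a \<in> pos_vecs (r + 1). inverse (ereal (sing_val (r + 1) (B_hat_mat n k r 0 a P)))) =
        (SUP a \<in> pos_vecs (r + 1). inverse (ereal (sing_val (r + 1) (B_mat n k r 0 a P))))"
      by (intro SUP_cong refl) (simp only: sing_val_B_hat[OF P z[unfolded z0]])
    thus "ed_dist s n k P 0 (r + 1)
        \<ge> (SUP a \<in> pos_vecs (r + 1). inverse (ereal (sing_val (r + 1) (B_hat_mat n k r 0 a P))))"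
      using bound by (simp only: z0)
  qed (rule bound)
qed

end
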